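(* Let $n\ge 2$, let $\mathcal{X}=C_2^n=\{0,1\}^n$, and let $G=S_n$ act on $\mathcal{X}$ by permuting coordinates. Let $K$ be the transition matrix of the Burnside process on $\mathcal{X}$ for this action, with stationary distribution $\pi$, and let $x_0=(1,1,\dots,1)$. Then for all $n\ge 2$ and all $l\in\{1,2,3,\dots\}$, $$\frac14\left(\frac14\right)^l\le \|K_{x_0}^l-\pi\|\le 4\left(\frac14\right)^l .$$
   Context: For a finite group $G$ acting on a finite set $\mathcal{X}$ (action written $x\mapsto x^g$), put $\mathcal{X}_g=\{y\in\mathcal{X}:y^g=y\}$ and $G_x=\{g\in G:x^g=x\}$, and let $O_x=\{x^g:g\in G\}$ be the orbit of $x$. The Burnside process is the Markov chain on $\mathcal{X}$ that, from $x$, chooses $g\in G_x$ uniformly at random and then, from $g$, chooses $y\in\mathcal{X}_g$ uniformly at random and moves to $y$. Its transition matrix is $$K(x,y)=\sum_{g\in G_x\cap G_y}\frac{1}{|G_x|}\frac{1}{|\mathcal{X}_g|},$$ and its stationary distribution is $\pi(x)=\frac{1}{z\,|O_x|}$, where $z$ is the number of orbits. For $\mathcal{X}=\{0,1\}^n$ and $G=S_n$, the orbit of $x$ is the set of all $y$ with the same number of ones as $x$, so $z=n+1$ and $\pi(x)=\frac{1}{(n+1)\binom{n}{|x|}}$, where $|x|$ is the number of ones in $x$. The total variation distance is $\|K_x^l-\pi\|=\frac12\sum_{y\in\mathcal{X}}|K^l(x,y)-\pi(y)|$, where $K^l$ is the $l$-th matrix power of $K$. *)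

theory Defs
  imports Complex_Main "HOL-Algebra.Group_Action" "HOL-Algebra.Sym_Groups"
begin

text \<open>
  A matrix indexed by a finite set \<open>X\<close> is a function of two arguments, only its values on
  \<open>X \<times> X\<close> being meaningful.
\<close>

primrec matrix_power :: "'a set \<Rightarrow> ('a \<Rightarrow> 'a \<Rightarrow> real) \<Rightarrow> nat \<Rightarrow> 'a \<Rightarrow> 'a \<Rightarrow> real" where
  "matrix_power X K 0 = (\<lambda>x y. if x = y then 1 else 0)"
| "matrix_power X K (Suc l) = (\<lambda>x y. \<Sum>z\<in>X. matrix_power X K l x z * K z y)"

definition total_variation :: "'a set \<Rightarrow> ('a \<Rightarrow> real) \<Rightarrow> ('a \<Rightarrow> real) \<Rightarrow> real" where
  "total_variation X \<mu> \<nu> = (1 / 2) * (\<Sum>y\<in>X. \<bar>\<mu> y - \<nu> y\<bar>)"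

definition burnside_kernel ::
    "('g, 'm) monoid_scheme \<Rightarrow> 'a set \<Rightarrow> ('g \<Rightarrow> 'a \<Rightarrow> 'a) \<Rightarrow> 'a \<Rightarrow> 'a \<Rightarrow> real" where
  "burnside_kernel G X \<phi> x y =
     (\<Sum>g \<in> stabilizer G \<phi> x \<inter> stabilizer G \<phi> y.
        1 / real (card (stabilizer G \<phi> x)) * (1 / real (card (invariants X \<phi> g))))"

definition burnside_stationary ::
    "('g, 'm) monoid_scheme \<Rightarrow> 'a set \<Rightarrow> ('g \<Rightarrow> 'a \<Rightarrow> 'a) \<Rightarrow> 'a \<Rightarrow> real" where
  "burnside_stationary G X \<phi> x =
     1 / (real (card (orbits G X \<phi>)) * real (card (orbit G \<phi> x)))"

definition binary_cube :: "nat \<Rightarrow> (nat \<Rightarrow> nat) set" where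
  "binary_cube n = {1..n} \<rightarrow>\<^sub>E {0, 1}"

text \<open>
  \<open>g\<close> sends \<open>x\<close> to \<open>x \<circ> g\<inverse>\<close>, i.e. it moves the entry in position \<open>i\<close> to position \<open>g i\<close>;
  the inverse makes this a left action, as \<^locale>\<open>group_action\<close> requires.  The outer restriction
  makes each \<open>perm_action n g\<close> an element of \<open>Bij (binary_cube n)\<close>.
\<close>

definition perm_action :: "nat \<Rightarrow> (nat \<Rightarrow> nat) \<Rightarrow> (nat \<Rightarrow> nat) \<Rightarrow> (nat \<Rightarrow> nat)" where
  "perm_action n g = (\<lambda>x \<in> binary_cube n. \<lambda>i \<in> {1..n}. x (inv' g i))"

definition all_ones :: "nat \<Rightarrow> (nat \<Rightarrow> nat)" where
  "all_ones n = (\<lambda>i \<in> {1..n}. 1)"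

lemma all_ones_in_binary_cube: "all_ones n \<in> binary_cube n"
  by (auto simp: all_ones_def binary_cube_def)

lemma finite_binary_cube: "finite (binary_cube n)"
  by (simp add: binary_cube_def finite_PiE)

lemma perm_action_closed:
  assumes "g permutes {1..n}" "x \<in> binary_cube n"
  shows "perm_action n g x \<in> binary_cube n"
proof -
  have "inv' g i \<in> {1..n}" if "i \<in> {1..n}" for i
    using permutes_in_image[OF permutes_inv[OF assms(1)]] that by blast
  then show ?thesis
    using assms(2) by (auto simp: perm_action_def binary_cube_def PiE_def Pi_def)
qed

lemma perm_action_comp:
  assumes "g permutes {1..n}" "h permutes {1..n}" "x \<in> binary_cube n"
  shows "perm_action n (g \<circ> h) x = perm_action n g (perm_action n h x)"
proof -
  have "inv' g i \<in> {1..n}" if "i \<in> {1..n}" for i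
    using permutes_in_image[OF permutes_inv[OF assms(1)]] that by blast
  moreover have "inv' (g \<circ> h) = inv' h \<circ> inv' g"
    using assms by (simp add: o_inv_distrib permutes_bij)
  ultimately show ?thesis
    using assms perm_action_closed[OF assms(2,3)]
    by (auto simp: perm_action_def fun_eq_iff restrict_def)
qed

lemma perm_action_id:
  assumes "x \<in> binary_cube n"
  shows "perm_action n id x = x"
  using assms by (auto simp: perm_action_def binary_cube_def PiE_def extensional_def fun_eq_iff)

lemma perm_action_Bij:
  assumes "g permutes {1..n}"
  shows "perm_action n g \<in> Bij (binary_cube n)"
proof -
  have "bij_betw (perm_action n g) (binary_cube n) (binary_cube n)"
  proof (rule bij_betw_byWitness[where f' = "perm_action n (inv' g)"])
    show "\<forall>x\<in>binary_cube n. perm_action n (inv' g) (perm_action n g x) = x"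
      using perm_action_comp[OF permutes_inv[OF assms] assms] perm_action_id
      by (simp add: permutes_inv_o(2)[OF assms])
    show "\<forall>x\<in>binary_cube n. perm_action n g (perm_action n (inv' g) x) = x"
      using perm_action_comp[OF assms permutes_inv[OF assms]] perm_action_id
      by (simp add: permutes_inv_o(1)[OF assms])
  qed (use perm_action_closed assms permutes_inv in blast)+
  then show ?thesis
    by (simp add: Bij_def perm_action_def)
qed

lemma group_action_perm_action:
  "group_action (sym_group n) (binary_cube n) (perm_action n)"
proof -
  have "perm_action n (g \<circ> h) = compose (binary_cube n) (perm_action n g) (perm_action n h)"
    if "g permutes {1..n}" "h permutes {1..n}" for g h
    using perm_action_comp[OF that]
    by (auto simp: compose_def fun_eq_iff) (simp add: perm_action_def)
  then have "perm_action n \<in> hom (sym_group n) (BijGroup (binary_cube n))"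
    using perm_action_Bij
    by (auto simp: hom_def sym_group_def BijGroup_def)
  then show ?thesis
    by (simp add: group_action_def group_hom_def group_hom_axioms_def
        sym_group_is_group group_BijGroup)
qed

text \<open>
  For every action of a finite group on a finite set, \<^const>\<open>burnside_kernel\<close> is a stochastic matrix
  and \<^const>\<open>burnside_stationary\<close> is a stationary distribution for it.
\<close>

context group_action
begin

lemma burnside_kernel_row_sum:
  assumes "finite (carrier G)" "finite E" "x \<in> E"
  shows "(\<Sum>y\<in>E. burnside_kernel G E \<phi> x y) = 1"
proof -
  let ?S = "stabilizer G \<phi> x"
  let ?c = "\<lambda>g. 1 / real (card ?S) * (1 / real (card (invariants E \<phi> g)))"
  have fin: "finite ?S"
    using assms(1) by (auto simp: stabilizer_def)
  have "?S \<noteq> {}"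
    using stabilizer_one_closed[OF assms(3)] by blast
  have "(\<Sum>y\<in>E. burnside_kernel G E \<phi> x y) = (\<Sum>y\<in>E. \<Sum>g\<in>?S. if \<phi> g y = y then ?c g else 0)"
    unfolding burnside_kernel_def
    by (intro sum.cong refl sum.mono_neutral_cong_left fin) (auto simp: stabilizer_def)
  also have "\<dots> = (\<Sum>g\<in>?S. \<Sum>y\<in>E. if \<phi> g y = y then ?c g else 0)"
    by (rule sum.swap)
  also have "\<dots> = (\<Sum>g\<in>?S. 1 / real (card ?S))"
  proof (rule sum.cong[OF refl])
    fix g assume g: "g \<in> ?S"
    then have "card (invariants E \<phi> g) \<noteq> 0"
      using assms(2,3) by (auto simp: stabilizer_def invariants_def)
    moreover have "(\<Sum>y\<in>E. if \<phi> g y = y then ?c g else 0) = (\<Sum>y\<in>invariants E \<phi> g. ?c g)"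
      by (rule sum.mono_neutral_cong_right) (auto simp: invariants_def assms(2))
    ultimately show "(\<Sum>y\<in>E. if \<phi> g y = y then ?c g else 0) = 1 / real (card ?S)"
      by simp
  qed
  also have "\<dots> = 1"
    using fin \<open>?S \<noteq> {}\<close> by simp
  finally show ?thesis .
qed

lemma burnside_detailed_balance:
  assumes "x \<in> E" "y \<in> E"
  shows "burnside_stationary G E \<phi> x * burnside_kernel G E \<phi> x y =
         burnside_stationary G E \<phi> y * burnside_kernel G E \<phi> y x"
proof -
  have eq: "real (card (orbit G \<phi> u)) * real (card (stabilizer G \<phi> u)) = real (order G)"
    if "u \<in> E" for u
    using orbit_stabilizer_theorem[OF that] by (metis of_nat_mult)
  have "burnside_stationary G E \<phi> u * burnside_kernel G E \<phi> u v =
        (\<Sum>g \<in> stabilizer G \<phi> u \<inter> stabilizer G \<phi> v.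
          1 / (real (card (orbits G E \<phi>)) * real (order G) * real (card (invariants E \<phi> g))))"
    if "u \<in> E" for u v
    unfolding burnside_stationary_def burnside_kernel_def sum_distrib_left eq[OF that, symmetric]
    by (simp add: mult.assoc)
  from this[OF assms(1)] this[OF assms(2)] show ?thesis
    by (simp add: Int_commute)
qed

lemma burnside_stationary_is_stationary:
  assumes "finite (carrier G)" "finite E" "y \<in> E"
  shows "(\<Sum>x\<in>E. burnside_stationary G E \<phi> x * burnside_kernel G E \<phi> x y) =
         burnside_stationary G E \<phi> y"
proof -
  have "(\<Sum>x\<in>E. burnside_stationary G E \<phi> x * burnside_kernel G E \<phi> x y) =
        (\<Sum>x\<in>E. burnside_stationary G E \<phi> y * burnside_kernel G E \<phi> y x)"
    using burnside_detailed_balance assms by (intro sum.cong) auto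
  also have "\<dots> = burnside_stationary G E \<phi> y"
    by (simp flip: sum_distrib_left add: burnside_kernel_row_sum[OF assms])
  finally show ?thesis .
qed

lemma burnside_stationary_sum:
  assumes "finite (carrier G)" "finite E" "E \<noteq> {}"
  shows "(\<Sum>x\<in>E. burnside_stationary G E \<phi> x) = 1"
proof -
  have part: "\<Union> (orbits G E \<phi>) = E" and "finite (orbits G E \<phi>)" "orbits G E \<phi> \<noteq> {}"
    using orbits_coverture assms(2,3) by (auto simp: orbits_def)
  have fin: "finite A" if "A \<in> orbits G E \<phi>" for A
    using that part assms(2) by (metis Union_upper finite_subset)
  have "(\<Sum>x\<in>E. burnside_stationary G E \<phi> x) =
        (\<Sum>A\<in>orbits G E \<phi>. \<Sum>x\<in>A. burnside_stationary G E \<phi> x)"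
  proof -
    have "\<forall>A\<in>orbits G E \<phi>. \<forall>B\<in>orbits G E \<phi>. A \<noteq> B \<longrightarrow> A \<inter> B = {}"
      using disjoint_union by blast
    with fin show ?thesis
      using sum.Union_disjoint[of "orbits G E \<phi>" "burnside_stationary G E \<phi>"]
      by (simp add: part)
  qed
  also have "\<dots> = (\<Sum>A\<in>orbits G E \<phi>. 1 / real (card (orbits G E \<phi>)))"
  proof (rule sum.cong[OF refl])
    fix A assume A: "A \<in> orbits G E \<phi>"
    have "orbit G \<phi> x = A" if "x \<in> A" for x
    proof -
      have "x \<in> E"
        using that A part by blast
      then have "x \<in> orbit G \<phi> x" "orbit G \<phi> x \<in> orbits G E \<phi>"
        using orbit_refl by (auto simp: orbits_def)
      then show ?thesis
        using disjoint_union[OF A] that by blast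
    qed
    moreover have "card A \<noteq> 0"
    proof -
      obtain u where "u \<in> E" "A = orbit G \<phi> u"
        using A unfolding orbits_def by blast
      then have "A \<noteq> {}"
        using orbit_refl by blast
      then show ?thesis
        using fin[OF A] by simp
    qed
    ultimately show "(\<Sum>x\<in>A. burnside_stationary G E \<phi> x) = 1 / real (card (orbits G E \<phi>))"
      by (simp add: burnside_stationary_def)
  qed
  also have "\<dots> = 1"
    using \<open>finite (orbits G E \<phi>)\<close> \<open>orbits G E \<phi> \<noteq> {}\<close> by simp
  finally show ?thesis .
qed

end

end

theory Submission
  imports Defs "HOL-Computational_Algebra.Polynomial" "HOL-Computational_Algebra.Formal_Power_Series"
begin

text \<open>
  Why the theorem holds.  Both \<open>K\<^sup>l(x\<^sub>0, y)\<close> and \<open>\<pi>(y)\<close> depend on \<open>y\<close> only through its number of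
  ones, so the distance is that of a chain on the levels \<open>{0..n}\<close> whose stationary law is uniform.

  The level chain is explicit.  With \<open>c\<^sub>a = (2a choose a) / 4\<^sup>a\<close>, it splits the \<open>i\<close> ones of the
  current state and its \<open>n - i\<close> zeros independently, a block of size \<open>m\<close> producing \<open>a\<close> new ones with
  probability \<open>c\<^sub>a c\<^bsub>m-a\<^esub>\<close>.  The reason is the identity
  \<open>\<Sum>g\<in>S\<^sub>m. 2 powr (- cycles g) = (1/2)(3/2)\<cdots>(m - 1/2) = m! c\<^sub>m\<close>, applied to the four blocks of
  coordinates on which the pair \<open>(x\<^sub>i, y\<^sub>i)\<close> is constant
  (\<open>sum_inverse_card_fixed_subsets\<close>, \<open>burnside_kernel_perm_action\<close>).  Reversibility then transfers
  the \<open>l\<close>-step law from the cube to the levels (\<open>matrix_power_burnside_kernel\<close>,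
  \<open>total_variation_burnside\<close>).

  The level chain is symmetric and maps polynomials of degree at most \<open>d\<close> to such polynomials,
  multiplying the coefficient of degree \<open>d\<close> by a number \<open>\<beta>\<^sub>d\<close> (\<open>polyfun_lumped_op\<close>).  A symmetric
  operator which is triangular with respect to degree is diagonal on the orthogonal polynomials of the
  uniform measure on \<open>{0..n}\<close>, the discrete Legendre polynomials (\<open>lumped_op_legendre\<close>).  The
  eigenvalues vanish for odd \<open>d\<close> and are \<open>\<beta>\<^bsub>2m\<^esub> = c\<^sub>m\<^sup>2\<close> (\<open>eigenvalue_eq\<close>), so the
  largest nontrivial one is \<open>\<beta>\<^sub>2 = 1/4\<close>, and \<open>\<beta>\<^sub>k \<le> 1/(k + 2)\<close> for \<open>k \<ge> 1\<close>.

  The lower bound tests the deviation from uniformity against the degree-two polynomial, which is \<open>1\<close> at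
  the starting level and bounded by \<open>2\<close>.  The upper bound is trivial for \<open>l = 1\<close>; for \<open>l \<ge> 2\<close>, the
  Cauchy-Schwarz inequality bounds four times the squared distance by
  \<open>\<Sum>k\<ge>1. \<beta>\<^sub>k\<^sup>2\<^sup>l (2k + 1)\<close>, the factor \<open>2k + 1\<close> coming from the norms of the Legendre
  polynomials.  Four of the \<open>2l\<close> factors \<open>\<beta>\<^sub>k\<close> make the series converge and the others contribute
  the rate \<open>1/16\<close> per step.
\<close>

section \<open>Normalised central binomial coefficients\<close>

text \<open>
  The number \<open>(2a choose a) / 4\<^sup>a\<close>, written with a Pochhammer symbol because it arises here as
  \<open>(1/2)(3/2)\<cdots>(a - 1/2) / a!\<close>.
\<close>
definition central :: "nat \<Rightarrow> real" where
  "central a = pochhammer (1 / 2) a / fact a"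

lemma central_0 [simp]: "central 0 = 1"
  by (simp add: central_def)

lemma central_pos: "central a > 0"
  by (simp add: central_def pochhammer_pos)

lemma central_Suc: "real (Suc a) * central (Suc a) = (real a + 1 / 2) * central a"
  by (simp add: central_def pochhammer_Suc field_simps del: of_nat_Suc)

text \<open>
  The coefficientwise form of \<open>(1 - u) powr (-x) * (1 - u) powr (-y) = (1 - u) powr (-(x + y))\<close>.
\<close>
lemma pochhammer_convolution:
  fixes x y :: "'a :: field_char_0"
  shows "(\<Sum>b\<le>k. pochhammer x b / fact b * (pochhammer y (k - b) / fact (k - b))) =
         pochhammer (x + y) k / fact k"
proof -
  have "pochhammer (x + y) k / fact k =
        (\<Sum>b\<le>k. of_nat (k choose b) * pochhammer x b * pochhammer y (k - b) / fact k)"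
    by (simp add: pochhammer_binomial_sum sum_divide_distrib)
  also have "\<dots> = (\<Sum>b\<le>k. pochhammer x b / fact b * (pochhammer y (k - b) / fact (k - b)))"
    by (intro sum.cong refl) (simp add: binomial_fact field_simps)
  finally show ?thesis ..
qed

text \<open>
  The \<open>d\<close>-th binomial moment of the distribution \<open>a \<mapsto> c\<^sub>a c\<^bsub>m-a\<^esub>\<close>.  It is a polynomial in \<open>m\<close>
  of degree \<open>d\<close>; this is why the level chain preserves degrees.  After absorbing the binomial
  coefficient into \<open>c\<^sub>a\<close>, the sum is a convolution with parameters \<open>1/2 + d\<close> and \<open>1/2\<close>.
\<close>
lemma central_convolution_binomial:
  "(\<Sum>a\<le>m. central a * central (m - a) * real (a choose d)) = central d * real (m choose d)"
proof (cases "d \<le> m")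
  case True
  have "(\<Sum>a\<le>m. central a * central (m - a) * real (a choose d)) =
        (\<Sum>a\<in>{d..m}. central a * central (m - a) * real (a choose d))"
    by (rule sum.mono_neutral_right) auto
  also have "\<dots> = (\<Sum>b\<le>m - d. central (d + b) * central (m - (d + b)) * real ((d + b) choose d))"
    by (rule sum.reindex_bij_witness[of _ "\<lambda>b. d + b" "\<lambda>a. a - d"]) (use True in auto)
  also have "\<dots> = (\<Sum>b\<le>m - d. central d * (pochhammer (1 / 2 + real d) b / fact b *
                                 (pochhammer (1 / 2) (m - d - b) / fact (m - d - b))))"
  proof (intro sum.cong refl)
    fix b assume "b \<in> {..m - d}"
    have "pochhammer (1 / 2) (d + b) = pochhammer (1 / 2) d * pochhammer (1 / 2 + real d) b"
      by (rule pochhammer_product')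
    moreover have "real ((d + b) choose d) = fact (d + b) / (fact d * fact b)"
      by (simp add: binomial_fact)
    ultimately show "central (d + b) * central (m - (d + b)) * real ((d + b) choose d) =
        central d * (pochhammer (1 / 2 + real d) b / fact b *
          (pochhammer (1 / 2) (m - d - b) / fact (m - d - b)))"
      by (simp add: central_def mult_ac)
  qed
  also have "\<dots> = central d * (pochhammer (1 + real d) (m - d) / fact (m - d))"
  proof -
    have "1 / 2 + real d + 1 / 2 = 1 + real d"
      by simp
    then show ?thesis
      unfolding sum_distrib_left[symmetric] pochhammer_convolution by (simp only:)
  qed
  also have "pochhammer (1 + real d) (m - d) / fact (m - d) = real (m choose d)"
    using True pochhammer_product'[of "1 :: real" d "m - d"]
    by (simp add: binomial_fact field_simps flip: pochhammer_fact)
  finally show ?thesis .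
next
  case False
  then show ?thesis by (simp add: binomial_eq_0)
qed

section \<open>The chain on levels\<close>

text \<open>
  The mean of \<open>f\<close> after one step from level \<open>i\<close>: independently, \<open>a\<close> of the \<open>i\<close> ones are kept and \<open>b\<close> of
  the \<open>n - i\<close> zeros become ones.
\<close>
definition lumped_op :: "nat \<Rightarrow> (nat \<Rightarrow> real) \<Rightarrow> nat \<Rightarrow> real" where
  "lumped_op n f i = (\<Sum>a\<le>i. \<Sum>b\<le>n - i.
     central a * central (i - a) * (central b * central (n - i - b)) * f (a + b))"

definition inner :: "nat \<Rightarrow> (nat \<Rightarrow> real) \<Rightarrow> (nat \<Rightarrow> real) \<Rightarrow> real" where
  "inner n f g = (\<Sum>j\<le>n. f j * g j)"

lemma inner_commute: "inner n f g = inner n g f"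
  by (simp add: inner_def mult.commute)

lemma inner_cong:
  "(\<And>j. j \<le> n \<Longrightarrow> f j = f' j) \<Longrightarrow> (\<And>j. j \<le> n \<Longrightarrow> g j = g' j) \<Longrightarrow> inner n f g = inner n f' g'"
  by (simp add: inner_def)

lemma inner_add_right: "inner n f (\<lambda>j. g j + h j) = inner n f g + inner n f h"
  by (simp add: inner_def algebra_simps sum.distrib)

lemma inner_diff_right: "inner n f (\<lambda>j. g j - h j) = inner n f g - inner n f h"
  by (simp add: inner_def algebra_simps sum_subtractf)

lemma inner_scale_right: "inner n f (\<lambda>j. c * g j) = c * inner n f g"
  by (simp add: inner_def sum_distrib_left mult_ac)

lemma inner_sum_right: "inner n f (\<lambda>j. \<Sum>k\<in>A. g k j) = (\<Sum>k\<in>A. inner n f (g k))"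
  unfolding inner_def sum_distrib_left by (rule sum.swap)

lemma inner_self_eq_0D: "inner n f f = 0 \<Longrightarrow> j \<le> n \<Longrightarrow> f j = 0"
  unfolding inner_def by (subst (asm) sum_nonneg_eq_0_iff) auto

lemma lumped_op_cong:
  assumes "\<And>j. j \<le> n \<Longrightarrow> f j = g j" "i \<le> n"
  shows "lumped_op n f i = lumped_op n g i"
  unfolding lumped_op_def by (intro sum.cong refl) (use assms in auto)

lemma lumped_op_add: "lumped_op n (\<lambda>j. f j + g j) i = lumped_op n f i + lumped_op n g i"
  by (simp add: lumped_op_def algebra_simps sum.distrib)

lemma lumped_op_scale: "lumped_op n (\<lambda>j. c * f j) i = c * lumped_op n f i"
  by (simp add: lumped_op_def sum_distrib_left mult_ac)

lemma lumped_op_sum: "finite A \<Longrightarrow> lumped_op n (\<lambda>j. \<Sum>k\<in>A. f k j) i = (\<Sum>k\<in>A. lumped_op n (f k) i)"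
  by (induction A rule: finite_induct) (simp_all add: lumped_op_add, simp add: lumped_op_def)

lemma lumped_op_nonneg: "(\<And>j. j \<le> n \<Longrightarrow> f j \<ge> 0) \<Longrightarrow> i \<le> n \<Longrightarrow> lumped_op n f i \<ge> 0"
  unfolding lumped_op_def
  by (intro sum_nonneg mult_nonneg_nonneg) (auto simp: less_imp_le central_pos)

text \<open>
  A transition from level \<open>i\<close> to level \<open>j\<close> is a quadruple \<open>(a, i - a, b, n - i - b)\<close> with \<open>j = a + b\<close>.
  Exchanging the two middle entries leaves the weight unchanged and swaps \<open>i\<close> with \<open>j\<close>.
\<close>
lemma inner_lumped_op_left: "inner n (lumped_op n f) g = inner n f (lumped_op n g)"
proof -
  define T where "T = (SIGMA i:{..n}. SIGMA a:{..i}. {..n - i})"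
  have "inner n (lumped_op n h) h' =
        (\<Sum>(i, a, b)\<in>T. central a * central (i - a) * (central b * central (n - i - b)) *
                        (h (a + b) * h' i))" for h h'
    unfolding inner_def lumped_op_def T_def
    by (simp add: sum.Sigma sum_distrib_left sum_distrib_right split_def mult.assoc)
  note expand = this
  have "inner n (lumped_op n f) g = inner n (lumped_op n g) f"
    unfolding expand
    by (rule sum.reindex_bij_witness[of _ "\<lambda>(i, a, b). (a + b, a, i - a)" "\<lambda>(i, a, b). (a + b, a, i - a)"])
       (auto simp: T_def mult_ac diff_diff_add add_ac)
  then show ?thesis by (simp add: inner_commute)
qed

text \<open>
  Vandermonde's identity separates the two independent blocks, and each contributes a binomial moment.
\<close>
lemma lumped_op_binomial:
  "lumped_op n (\<lambda>j. real (j choose d)) i =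
   (\<Sum>s\<le>d. central s * central (d - s) * (real (i choose s) * real ((n - i) choose (d - s))))"
proof -
  have "lumped_op n (\<lambda>j. real (j choose d)) i =
        (\<Sum>a\<le>i. \<Sum>b\<le>n - i. \<Sum>s\<le>d. (central a * central (i - a) * real (a choose s)) *
             (central b * central (n - i - b) * real (b choose (d - s))))"
    unfolding lumped_op_def vandermonde[symmetric] of_nat_sum of_nat_mult sum_distrib_left
    by (intro sum.cong refl) (simp only: mult_ac)
  also have "\<dots> = (\<Sum>a\<le>i. \<Sum>s\<le>d. \<Sum>b\<le>n - i. (central a * central (i - a) * real (a choose s)) *
             (central b * central (n - i - b) * real (b choose (d - s))))"
    by (intro sum.cong refl sum.swap)
  also have "\<dots> = (\<Sum>s\<le>d. \<Sum>a\<le>i. \<Sum>b\<le>n - i. (central a * central (i - a) * real (a choose s)) *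
             (central b * central (n - i - b) * real (b choose (d - s))))"
    by (rule sum.swap)
  also have "\<dots> = (\<Sum>s\<le>d. (\<Sum>a\<le>i. central a * central (i - a) * real (a choose s)) *
             (\<Sum>b\<le>n - i. central b * central (n - i - b) * real (b choose (d - s))))"
    by (simp only: sum_product)
  finally show ?thesis
    unfolding central_convolution_binomial by (simp only: mult_ac)
qed

section \<open>Polynomial functions on the levels\<close>

text \<open>
  The function \<open>f\<close> agrees on \<open>{0..n}\<close> with a polynomial of degree at most \<open>d\<close> whose coefficient of
  degree \<open>d\<close> is \<open>\<alpha>\<close>.  Allowing \<open>\<alpha> = 0\<close> makes the predicate additive and multiplicative in the pair
  \<open>(\<alpha>, f)\<close>, so leading coefficients are computed along with the polynomials.
\<close>
definition polyfun :: "nat \<Rightarrow> nat \<Rightarrow> real \<Rightarrow> (nat \<Rightarrow> real) \<Rightarrow> bool" where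
  "polyfun n d \<alpha> f \<longleftrightarrow>
     (\<exists>p. degree p \<le> d \<and> coeff p d = \<alpha> \<and> (\<forall>i\<le>n. f i = poly p (real i)))"

lemma polyfunI:
  "degree p \<le> d \<Longrightarrow> coeff p d = \<alpha> \<Longrightarrow> (\<And>i. i \<le> n \<Longrightarrow> f i = poly p (real i)) \<Longrightarrow> polyfun n d \<alpha> f"
  by (auto simp: polyfun_def)

lemma polyfun_cong:
  "polyfun n d \<alpha> f \<Longrightarrow> \<alpha> = \<beta> \<Longrightarrow> (\<And>i. i \<le> n \<Longrightarrow> g i = f i) \<Longrightarrow> polyfun n d \<beta> g"
  by (auto simp: polyfun_def)

lemma polyfun_const: "polyfun n 0 c (\<lambda>i. c)"
  by (rule polyfunI[of "[:c:]"]) auto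

lemma polyfun_linear: "polyfun n 1 b (\<lambda>i. a + b * real i)"
  by (rule polyfunI[of "[:a, b:]"]) (auto simp: mult.commute)

lemma polyfun_add:
  assumes "polyfun n d \<alpha> f" "polyfun n d \<beta> g"
  shows "polyfun n d (\<alpha> + \<beta>) (\<lambda>i. f i + g i)"
proof -
  from assms obtain p q where
    "degree p \<le> d" "coeff p d = \<alpha>" "\<forall>i\<le>n. f i = poly p (real i)"
    "degree q \<le> d" "coeff q d = \<beta>" "\<forall>i\<le>n. g i = poly q (real i)"
    by (auto simp: polyfun_def)
  then show ?thesis
    by (intro polyfunI[of "p + q"] degree_add_le) auto
qed

lemma polyfun_mult:
  assumes "polyfun n d \<alpha> f" "polyfun n e \<beta> g"
  shows "polyfun n (d + e) (\<alpha> * \<beta>) (\<lambda>i. f i * g i)"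
proof -
  from assms obtain p q where
    p: "degree p \<le> d" "coeff p d = \<alpha>" "\<forall>i\<le>n. f i = poly p (real i)" and
    q: "degree q \<le> e" "coeff q e = \<beta>" "\<forall>i\<le>n. g i = poly q (real i)"
    by (auto simp: polyfun_def)
  have "coeff p i * coeff q (d + e - i) = 0" if "i \<noteq> d" for i
  proof (cases "i < d")
    case True
    then have "degree q < d + e - i" using q(1) by simp
    then show ?thesis by (simp add: coeff_eq_0)
  next
    case False
    then have "degree p < i" using that p(1) by simp
    then show ?thesis by (simp add: coeff_eq_0)
  qed
  then have "coeff (p * q) (d + e) = (\<Sum>i\<in>{d}. coeff p i * coeff q (d + e - i))"
    unfolding coeff_mult by (intro sum.mono_neutral_right) auto
  moreover have "degree (p * q) \<le> d + e"
    using degree_mult_le[of p q] p(1) q(1) by simp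
  ultimately show ?thesis
    using p q by (intro polyfunI[of "p * q"]) auto
qed

lemma polyfun_scale: "polyfun n d \<alpha> f \<Longrightarrow> polyfun n d (c * \<alpha>) (\<lambda>i. c * f i)"
  using polyfun_mult[OF polyfun_const, of n d \<alpha> f c] by simp

lemma polyfun_mono: "polyfun n d \<alpha> f \<Longrightarrow> d < e \<Longrightarrow> polyfun n e 0 f"
  unfolding polyfun_def by (metis coeff_eq_0 le_less_trans less_imp_le)

lemma polyfun_sum:
  "finite A \<Longrightarrow> (\<And>k. k \<in> A \<Longrightarrow> polyfun n d (\<alpha> k) (f k)) \<Longrightarrow>
   polyfun n d (\<Sum>k\<in>A. \<alpha> k) (\<lambda>i. \<Sum>k\<in>A. f k i)"
proof (induction A rule: finite_induct)
  case empty
  show ?case by (rule polyfunI[of 0]) auto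
qed (simp add: polyfun_add)

lemma polyfun_diff:
  "polyfun n d \<alpha> f \<Longrightarrow> polyfun n d \<beta> g \<Longrightarrow> polyfun n d (\<alpha> - \<beta>) (\<lambda>i. f i - g i)"
  using polyfun_add[of n d \<alpha> f "-1 * \<beta>" "\<lambda>i. -1 * g i"] polyfun_scale[of n d \<beta> g "-1"] by simp

lemma polyfun_Suc_0D:
  assumes "polyfun n (Suc d) 0 f"
  obtains \<alpha> where "polyfun n d \<alpha> f"
proof -
  from assms obtain p where p: "degree p \<le> Suc d" "coeff p (Suc d) = 0" "\<forall>i\<le>n. f i = poly p (real i)"
    by (auto simp: polyfun_def)
  then have "degree p \<le> d"
    by (metis degree_0 le_SucE le0 leading_coeff_0_iff)
  with p that show thesis
    by (auto simp: polyfun_def)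
qed

lemma polyfun_0_0D: "polyfun n 0 0 f \<Longrightarrow> i \<le> n \<Longrightarrow> f i = 0"
  by (auto simp: polyfun_def elim!: degree_eq_zeroE)

text \<open>
  Functions \<open>b 0, \<dots>, b d\<close> of exact degrees \<open>0, \<dots>, d\<close> span the polynomial functions of degree at most
  \<open>d\<close>, hence a property closed under linear combinations need only be checked on them.
\<close>
lemma polyfun_basis_induct [consumes 1, case_names basis zero combine]:
  assumes f: "polyfun n d \<alpha> f"
    and basis: "\<And>k. k \<le> d \<Longrightarrow> polyfun n k (\<beta> k) (b k) \<and> \<beta> k \<noteq> 0 \<and> P (b k)"
    and zero: "\<And>f. (\<And>i. i \<le> n \<Longrightarrow> f i = 0) \<Longrightarrow> P f"
    and comb: "\<And>f g c. P f \<Longrightarrow> P g \<Longrightarrow> P (\<lambda>i. f i + c * g i)"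
  shows "P f"
  using f basis
proof (induction d arbitrary: \<alpha> f)
  case 0
  define c where "c = \<alpha> / \<beta> 0"
  have "polyfun n 0 (\<alpha> - c * \<beta> 0) (\<lambda>i. f i - c * b 0 i)"
    using 0 by (intro polyfun_diff polyfun_scale) auto
  then have "P (\<lambda>i. f i - c * b 0 i)"
    using 0(2)[of 0] by (intro zero) (auto simp: c_def dest: polyfun_0_0D)
  from comb[OF this, of "b 0" c] show ?case
    using 0(2)[of 0] by simp
next
  case (Suc d)
  define c where "c = \<alpha> / \<beta> (Suc d)"
  have "polyfun n (Suc d) (\<alpha> - c * \<beta> (Suc d)) (\<lambda>i. f i - c * b (Suc d) i)"
    using Suc.prems by (intro polyfun_diff polyfun_scale) auto
  moreover have "\<alpha> - c * \<beta> (Suc d) = 0"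
    using Suc.prems(2)[of "Suc d"] by (simp add: c_def)
  ultimately obtain \<alpha>' where "polyfun n d \<alpha>' (\<lambda>i. f i - c * b (Suc d) i)"
    by (metis polyfun_Suc_0D)
  then have "P (\<lambda>i. f i - c * b (Suc d) i)"
    by (rule Suc.IH) (use Suc.prems(2) in auto)
  from comb[OF this, of "b (Suc d)" c] show ?case
    using Suc.prems(2)[of "Suc d"] by simp
qed

lemma binomial_Suc_right: "real (j choose Suc d) * real (Suc d) = real (j choose d) * (real j - real d)"
proof (cases "d \<le> j")
  case True
  have "Suc d * (j choose Suc d) = (j - d) * (j choose d)"
    unfolding binomial_absorption binomial_absorb_comp ..
  then have "real (Suc d * (j choose Suc d)) = real ((j - d) * (j choose d))"
    by (rule arg_cong)
  then show ?thesis
    using True by (simp only: of_nat_mult of_nat_diff mult.commute)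
qed (simp add: binomial_eq_0)

text \<open>
  Each of the three families of binomial coefficients below gains a linear factor when its lower index
  is raised by one, so its degree and leading coefficient follow by induction from this step.
\<close>
lemma polyfun_product_step:
  assumes "polyfun n d \<alpha> f"
    and "\<And>i. i \<le> n \<Longrightarrow> g i * real (Suc d) = f i * (a + b * real i)"
  shows "polyfun n (Suc d) (\<alpha> * b / real (Suc d)) g"
proof -
  have "polyfun n (d + 1) (\<alpha> * (b / real (Suc d)))
          (\<lambda>i. f i * (a / real (Suc d) + b / real (Suc d) * real i))"
    by (intro polyfun_mult assms(1) polyfun_linear)
  then have "polyfun n (Suc d) (\<alpha> * (b / real (Suc d)))
          (\<lambda>i. f i * (a / real (Suc d) + b / real (Suc d) * real i))"
    by (simp only: Suc_eq_plus1)
  then show ?thesis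
  proof (rule polyfun_cong)
    fix i assume "i \<le> n"
    from assms(2)[OF this] show "g i = f i * (a / real (Suc d) + b / real (Suc d) * real i)"
      by (simp add: field_simps del: of_nat_Suc)
  qed auto
qed

lemma polyfun_binomial: "polyfun n d (1 / fact d) (\<lambda>j. real (j choose d))"
proof (induction d)
  case 0
  show ?case using polyfun_const[of n 1] by simp
next
  case (Suc d)
  have "polyfun n (Suc d) (1 / fact d * 1 / real (Suc d)) (\<lambda>j. real (j choose Suc d))"
    by (rule polyfun_product_step[OF Suc, where a = "- real d"]) (simp add: binomial_Suc_right del: of_nat_Suc)
  then show ?case by (simp add: mult.commute del: of_nat_Suc)
qed

lemma polyfun_binomial_reflect: "polyfun n d ((-1) ^ d / fact d) (\<lambda>j. real ((n - j) choose d))"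
proof (induction d)
  case 0
  show ?case using polyfun_const[of n 1] by simp
next
  case (Suc d)
  have "polyfun n (Suc d) ((-1) ^ d / fact d * (-1) / real (Suc d)) (\<lambda>j. real ((n - j) choose Suc d))"
    by (rule polyfun_product_step[OF Suc, where a = "real n - real d"])
       (simp add: binomial_Suc_right of_nat_diff del: of_nat_Suc)
  then show ?case by (simp add: mult.commute del: of_nat_Suc)
qed

lemma polyfun_rising: "polyfun n m (1 / fact m) (\<lambda>j. real ((j + m) choose m))"
proof (induction m)
  case 0
  show ?case using polyfun_const[of n 1] by simp
next
  case (Suc m)
  have "polyfun n (Suc m) (1 / fact m * 1 / real (Suc m)) (\<lambda>j. real ((j + Suc m) choose Suc m))"
  proof (rule polyfun_product_step[OF Suc, where a = "real (Suc m)"])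
    fix j
    have "Suc m * (Suc (j + m) choose Suc m) = Suc (j + m) * ((j + m) choose m)"
      using Suc_times_binomial_eq[of "j + m" m] by (simp only: mult.commute)
    then have "real (Suc m * (Suc (j + m) choose Suc m)) = real (Suc (j + m) * ((j + m) choose m))"
      by (rule arg_cong)
    then show "real ((j + Suc m) choose Suc m) * real (Suc m) =
               real ((j + m) choose m) * (real (Suc m) + 1 * real j)"
      by (simp add: algebra_simps)
  qed
  then show ?case by (simp add: mult.commute del: of_nat_Suc)
qed

section \<open>The eigenvalues\<close>

text \<open>
  The factor by which the level chain multiplies the coefficient of degree \<open>d\<close>; the sign comes from
  the argument \<open>n - i\<close> of the second block.
\<close>
definition eigenvalue :: "nat \<Rightarrow> real" where
  "eigenvalue d = (\<Sum>a\<le>d. real (d choose a) * (-1) ^ (d - a) * (central a * central (d - a)))"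

text \<open>
  For \<open>f j = (j choose d)\<close> this is read off from the formula for binomial moments.  The difference of
  \<open>f\<close> and the right multiple of that function has smaller degree.
\<close>
lemma polyfun_lumped_op:
  assumes "polyfun n d \<alpha> f"
  shows "polyfun n d (eigenvalue d * \<alpha>) (lumped_op n f)"
  using assms
proof (induction d arbitrary: \<alpha> f rule: less_induct)
  case (less d)
  define g where "g = (\<lambda>j. real (j choose d))"
  have lumped_g: "polyfun n d (eigenvalue d / fact d) (lumped_op n g)"
  proof -
    have "polyfun n d (\<Sum>s\<le>d. central s * central (d - s) * (1 / fact s * ((-1) ^ (d - s) / fact (d - s))))
       (\<lambda>i. \<Sum>s\<le>d. central s * central (d - s) * (real (i choose s) * real ((n - i) choose (d - s))))"
    proof (intro polyfun_sum polyfun_scale)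
      fix s assume "s \<in> {..d}"
      then show "polyfun n d (1 / fact s * ((-1) ^ (d - s) / fact (d - s)))
              (\<lambda>i. real (i choose s) * real ((n - i) choose (d - s)))"
        using polyfun_mult[OF polyfun_binomial polyfun_binomial_reflect, of n s "d - s"] by simp
    qed simp
    then show ?thesis
    proof (rule polyfun_cong)
      show "(\<Sum>s\<le>d. central s * central (d - s) * (1 / fact s * ((-1) ^ (d - s) / fact (d - s)))) =
            eigenvalue d / fact d"
        unfolding eigenvalue_def sum_divide_distrib
        by (intro sum.cong refl) (simp add: binomial_fact)
    qed (simp add: g_def lumped_op_binomial)
  qed
  define h where "h = (\<lambda>j. f j - \<alpha> * fact d * g j)"
  have "polyfun n d (\<alpha> - \<alpha> * fact d * (1 / fact d)) h"
    unfolding h_def g_def by (intro polyfun_diff less.prems polyfun_scale polyfun_binomial)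
  then have h: "polyfun n d 0 h"
    by simp
  have lumped_h: "polyfun n d 0 (lumped_op n h)"
  proof (cases d)
    case 0
    then have h0: "h j = 0" if "j \<le> n" for j
      using h polyfun_0_0D that by blast
    have "lumped_op n h i = 0" if "i \<le> n" for i
      using lumped_op_cong[of n h "\<lambda>_. 0" i] h0 that by (simp add: lumped_op_def)
    then show ?thesis by (intro polyfunI[of 0]) auto
  next
    case (Suc e)
    then obtain \<beta> where "polyfun n e \<beta> h"
      using h polyfun_Suc_0D by blast
    then have "polyfun n e (eigenvalue e * \<beta>) (lumped_op n h)"
      using Suc by (intro less.IH) auto
    then show ?thesis using Suc by (intro polyfun_mono) auto
  qed
  have "polyfun n d (0 + \<alpha> * fact d * (eigenvalue d / fact d)) (\<lambda>i. lumped_op n h i + \<alpha> * fact d * lumped_op n g i)"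
    by (intro polyfun_add lumped_h polyfun_scale lumped_g)
  then show ?case
  proof (rule polyfun_cong)
    fix i
    have "lumped_op n f i = lumped_op n (\<lambda>j. h j + \<alpha> * fact d * g j) i"
      by (simp add: h_def)
    then show "lumped_op n f i = lumped_op n h i + \<alpha> * fact d * lumped_op n g i"
      by (simp add: lumped_op_add lumped_op_scale)
  qed simp
qed

text \<open>
  Up to the factor \<open>d!\<close>, the sum defining the \<open>d\<close>-th eigenvalue is a coefficient of \<open>G(x) G(-x)\<close>, where
  \<open>G(x) = \<Sum>a. c\<^sub>a x\<^sup>a / a!\<close> is the following series.  It equals \<open>exp (x/2) I\<^sub>0(x/2)\<close> with the modified
  Bessel function \<open>I\<^sub>0\<close>, an even function, so the exponentials cancel in the product.
\<close>
definition central_egf :: "real fps" where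
  "central_egf = Abs_fps (\<lambda>a. central a / fact a)"

lemma central_egf_nth: "fps_nth central_egf a = central a / fact a"
  by (simp add: central_egf_def)

text \<open>
  The confluent hypergeometric equation, equivalent to the recurrence
  \<open>(a + 1) c\<^bsub>a+1\<^esub> = (a + 1/2) c\<^sub>a\<close>.
\<close>
lemma central_egf_ode:
  "fps_X * fps_deriv (fps_deriv central_egf) + (1 - fps_X) * fps_deriv central_egf =
     fps_const (1 / 2) * central_egf"
proof (rule fps_ext)
  fix a
  have c: "real (Suc a) * (real (Suc a) * fps_nth central_egf (Suc a)) = (real a + 1 / 2) * fps_nth central_egf a"
  proof -
    have "real (Suc a) * (real (Suc a) * fps_nth central_egf (Suc a)) = real (Suc a) * central (Suc a) / fact a"
      by (simp add: central_egf_nth field_simps del: of_nat_Suc)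
    then show ?thesis
      unfolding central_Suc by (simp add: central_egf_nth)
  qed
  have "fps_nth (fps_X * fps_deriv (fps_deriv central_egf) + (1 - fps_X) * fps_deriv central_egf) a =
        real (Suc a) * (real (Suc a) * fps_nth central_egf (Suc a)) - real a * fps_nth central_egf a"
    by (cases a) (simp_all add: left_diff_distrib, simp add: algebra_simps)
  then show "fps_nth (fps_X * fps_deriv (fps_deriv central_egf) + (1 - fps_X) * fps_deriv central_egf) a =
        fps_nth (fps_const (1 / 2) * central_egf) a"
    unfolding c by (simp add: algebra_simps)
qed

text \<open>
  Multiplication by \<open>exp (-x/2)\<close> turns the equation for \<open>G\<close> into the modified Bessel equation
  \<open>x H'' + H' = x H / 4\<close>, a two-term recurrence linking coefficients whose indices differ by \<open>2\<close>.
\<close>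
lemma central_egf_even:
  defines "H \<equiv> fps_exp (- 1 / 2) * central_egf"
  shows "fps_nth H a = (if even a then 1 / (16 ^ (a div 2) * fact (a div 2) ^ 2) else 0)"
proof -
  define C where "C = (fps_const (1 / 2) :: real fps)"
  define E where "E = (fps_exp (- 1 / 2) :: real fps)"
  define G' where "G' = fps_deriv central_egf"
  define G'' where "G'' = fps_deriv G'"
  have C: "C + C = 1" "C * C = fps_const (1 / 4)" "fps_deriv C = 0"
    by (simp_all add: C_def)
  have E': "fps_deriv E = - (C * E)"
    by (simp add: E_def C_def flip: fps_const_neg)
  have G: "fps_X * G'' + (1 - fps_X) * G' = C * central_egf"
    unfolding G'_def G''_def C_def by (rule central_egf_ode)
  have H: "H = E * central_egf"
    by (simp add: H_def E_def)
  have H': "fps_deriv H = E * (G' - C * central_egf)"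
    unfolding H by (simp add: E' G'_def algebra_simps)
  have H'': "fps_deriv (fps_deriv H) = E * (G'' - (C + C) * G' + C * C * central_egf)"
    unfolding H' by (simp add: E' C(3) G''_def G'_def[symmetric] algebra_simps)
  have "fps_X * fps_deriv (fps_deriv H) + fps_deriv H - C * C * (fps_X * H) =
        E * (fps_X * G'' + (1 - fps_X) * G' - C * central_egf)"
    unfolding H'' unfolding H' C(1) unfolding H by (simp add: algebra_simps)
  then have ode: "fps_X * fps_deriv (fps_deriv H) + fps_deriv H = fps_const (1 / 4) * (fps_X * H)"
    unfolding G C(2) by simp
  have H0: "fps_nth H 0 = 1"
    by (simp add: H_def central_egf_nth)
  have H1: "fps_nth H (Suc 0) = 0"
    using arg_cong[OF ode, of "\<lambda>F. fps_nth F 0"] by simp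
  have step: "fps_nth H (Suc (Suc a)) = fps_nth H a / (4 * real (Suc (Suc a)) ^ 2)" for a
  proof -
    have "4 * real (Suc (Suc a)) ^ 2 * fps_nth H (Suc (Suc a)) = fps_nth H a"
      using arg_cong[OF ode, of "\<lambda>F. fps_nth F (Suc a)"]
      by (simp add: power2_eq_square algebra_simps)
    then show ?thesis
      by (simp add: eq_divide_eq mult.commute del: of_nat_Suc)
  qed
  show ?thesis
  proof (induction a rule: induct_nat_012)
    case (ge2 a)
    show ?case
      unfolding step ge2(1) by (auto elim!: evenE simp: power2_eq_square field_simps)
  qed (simp_all add: H0 H1)
qed

text \<open>
  The coefficients of \<open>H(x)\<^sup>2\<close> of even index \<open>2m\<close> are, up to a factor, \<open>\<Sum>j\<le>m. (m choose j)\<^sup>2\<close>,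
  that is \<open>(2m choose m)\<close>.
\<close>
lemma eigenvalue_eq: "eigenvalue d = (if even d then central (d div 2) ^ 2 else 0)"
proof -
  define H where "H = fps_exp (- 1 / 2) * central_egf"
  have H_nth: "fps_nth H a = (if even a then 1 / (16 ^ (a div 2) * fact (a div 2) ^ 2) else 0)" for a
    unfolding H_def by (rule central_egf_even)
  have G1: "central_egf = fps_exp (1 / 2) * H"
    by (simp add: H_def mult.assoc[symmetric] flip: fps_exp_add_mult)
  \<comment> \<open>The series \<open>G(-x)\<close>: the coefficients of \<open>H\<close> do not notice the sign because \<open>H\<close> is even.\<close>
  have G2: "Abs_fps (\<lambda>a. (-1) ^ a * fps_nth central_egf a) = fps_exp (- 1 / 2) * H"
  proof (rule fps_ext)
    fix a
    have "fps_nth (fps_exp (- 1 / 2) * H) a = (\<Sum>i=0..a. (-1) ^ a * ((1 / 2) ^ i / fact i * fps_nth H (a - i)))"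
      unfolding fps_mult_nth
    proof (intro sum.cong refl)
      fix i assume "i \<in> {0..a}"
      then have "(- 1) ^ a = (- 1 :: real) ^ i * (- 1) ^ (a - i)"
        by (simp flip: power_add)
      then show "fps_nth (fps_exp (- 1 / 2)) i * fps_nth H (a - i) =
                 (- 1) ^ a * ((1 / 2) ^ i / fact i * fps_nth H (a - i))"
        by (simp add: H_nth power_minus[of "1 / 2"] power_divide)
    qed
    also have "\<dots> = (-1) ^ a * fps_nth central_egf a"
      unfolding G1 fps_mult_nth by (simp add: sum_distrib_left)
    finally show "fps_nth (Abs_fps (\<lambda>a. (-1) ^ a * fps_nth central_egf a)) a =
                  fps_nth (fps_exp (- 1 / 2) * H) a" by simp
  qed
  have "fps_exp (1 / 2) * fps_exp (- 1 / 2) = (1 :: real fps)"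
    by (simp flip: fps_exp_add_mult)
  then have prod: "central_egf * Abs_fps (\<lambda>a. (-1) ^ a * fps_nth central_egf a) = H * H"
    unfolding G2 by (subst G1) (simp add: mult_ac flip: mult.assoc)
  have "eigenvalue d = fact d * fps_nth (central_egf * Abs_fps (\<lambda>a. (-1) ^ a * fps_nth central_egf a)) d"
    unfolding eigenvalue_def fps_mult_nth sum_distrib_left atMost_atLeast0
    by (intro sum.cong refl) (simp add: central_egf_nth binomial_fact)
  also have "\<dots> = fact d * (\<Sum>i\<le>d. fps_nth H i * fps_nth H (d - i))"
    unfolding prod fps_mult_nth atMost_atLeast0 ..
  also have "\<dots> = (if even d then central (d div 2) ^ 2 else 0)"
  proof (cases "even d")
    case False
    then have "fps_nth H i * fps_nth H (d - i) = 0" if "i \<le> d" for i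
      using that by (simp add: H_nth)
    then have "(\<Sum>i\<le>d. fps_nth H i * fps_nth H (d - i)) = 0"
      by (intro sum.neutral) simp
    then show ?thesis using False by simp
  next
    case True
    then obtain m where m: "d = 2 * m" by blast
    have "(\<Sum>i\<le>d. fps_nth H i * fps_nth H (d - i)) =
          (\<Sum>i\<in>(\<lambda>j. 2 * j) ` {..m}. fps_nth H i * fps_nth H (d - i))"
    proof (rule sum.mono_neutral_right)
      show "\<forall>i\<in>{..d} - (\<lambda>j. 2 * j) ` {..m}. fps_nth H i * fps_nth H (d - i) = 0"
        by (auto simp: H_nth m image_iff elim!: evenE)
    qed (auto simp: m)
    also have "\<dots> = (\<Sum>j\<le>m. fps_nth H (2 * j) * fps_nth H (2 * (m - j)))"
      by (subst sum.reindex) (auto simp: m inj_on_def diff_mult_distrib2)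
    also have "\<dots> = (\<Sum>j\<le>m. real ((m choose j)\<^sup>2) / (16 ^ m * fact m ^ 2))"
    proof (intro sum.cong refl)
      fix j assume "j \<in> {..m}"
      then have "(16 :: real) ^ m = 16 ^ j * 16 ^ (m - j)"
        by (simp flip: power_add)
      with \<open>j \<in> {..m}\<close> show "fps_nth H (2 * j) * fps_nth H (2 * (m - j)) = real ((m choose j)\<^sup>2) / (16 ^ m * fact m ^ 2)"
        by (simp add: H_nth binomial_fact power_divide power_mult_distrib)
    qed
    also have "\<dots> = real ((2 * m) choose m) / (16 ^ m * fact m ^ 2)"
      by (simp only: choose_square_sum flip: sum_divide_distrib of_nat_sum)
    finally have "fact d * (\<Sum>i\<le>d. fps_nth H i * fps_nth H (d - i)) =
        (fact (2 * m)) ^ 2 / (16 ^ m * fact m ^ 4)"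
      by (simp add: m binomial_fact power2_eq_square power4_eq_xxxx)
    also have "\<dots> = central m ^ 2"
    proof -
      have "(16 :: real) ^ m = 4 ^ m * 4 ^ m"
        by (simp flip: power_mult_distrib)
      then show ?thesis
        unfolding fact_double central_def
        by (simp add: power_mult_distrib power_divide power2_eq_square power4_eq_xxxx power_mult)
    qed
    finally show ?thesis using True by (simp add: m)
  qed
  finally show ?thesis .
qed

lemma eigenvalue_0 [simp]: "eigenvalue 0 = 1"
  by (simp add: eigenvalue_eq)

lemma eigenvalue_2: "eigenvalue 2 = 1 / 4"
  by (simp add: eigenvalue_eq central_def power2_eq_square)

text \<open>
  The shift by one is essential: for \<open>c\<^sub>0\<^sup>2 = 1\<close> the corresponding bound \<open>1/2\<close> fails.
\<close>
lemma central_sq_le: "central (Suc m) ^ 2 \<le> 1 / (2 * real m + 4)"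
proof (induction m)
  case 0
  show ?case by (simp add: central_def power2_eq_square)
next
  case (Suc m)
  have c: "central (Suc (Suc m)) = (real m + 3 / 2) / (real m + 2) * central (Suc m)"
    using central_Suc[of "Suc m"] by (simp add: field_simps)
  have "central (Suc (Suc m)) ^ 2 \<le> ((real m + 3 / 2) / (real m + 2)) ^ 2 * (1 / (2 * real m + 4))"
    unfolding c power_mult_distrib by (intro mult_left_mono Suc) auto
  also have "\<dots> = (real m + 3 / 2)^2 / (2 * (real m + 2) ^ 3)"
    by (simp add: power2_eq_square power3_eq_cube field_simps)
  also have "\<dots> \<le> 1 / (2 * real m + 6)"
  proof -
    have "(real m + 3 / 2)^2 * (2 * real m + 6) \<le> 2 * (real m + 2) ^ 3"
      by (simp add: power2_eq_square power3_eq_cube algebra_simps)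
    then show ?thesis
      by (simp add: pos_divide_le_eq pos_le_divide_eq)
  qed
  finally show ?case by (simp add: algebra_simps)
qed

lemma eigenvalue_bounds:
  assumes "k \<ge> 1"
  shows "0 \<le> eigenvalue k" "eigenvalue k \<le> 1 / (real k + 2)" "eigenvalue k \<le> 1 / 4"
proof -
  show "0 \<le> eigenvalue k" by (simp add: eigenvalue_eq)
  have "eigenvalue k \<le> 1 / (real k + 2) \<and> eigenvalue k \<le> 1 / 4"
  proof (cases "even k")
    case True
    then obtain m where "k = 2 * Suc m"
      using assms by (metis One_nat_def evenE not_less_eq_eq old.nat.exhaust mult_0_right order_refl)
    then have "eigenvalue k \<le> 1 / (real k + 2)" and k: "real k \<ge> 2"
      using central_sq_le[of m] by (simp_all add: eigenvalue_eq algebra_simps)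
    moreover have "1 / (real k + 2) \<le> 1 / 4"
      using k by (intro divide_left_mono) auto
    ultimately show ?thesis by linarith
  qed (simp add: eigenvalue_eq)
  then show "eigenvalue k \<le> 1 / (real k + 2)" "eigenvalue k \<le> 1 / 4" by auto
qed

section \<open>Discrete Legendre polynomials\<close>

text \<open>
  An alternating binomial sum is an iterated difference, so Pascal's rule peels off one difference
  at a time.
\<close>
lemma alternating_binomial_Suc:
  fixes f :: "nat \<Rightarrow> real"
  shows "(\<Sum>a\<le>Suc k. (-1) ^ a * real (Suc k choose a) * f a) =
         (\<Sum>a\<le>k. (-1) ^ a * real (k choose a) * (f a - f (Suc a)))"
proof -
  have "(\<Sum>a\<le>Suc k. (-1) ^ a * real (Suc k choose a) * f a) =
        f 0 + (\<Sum>a\<le>k. (-1) ^ Suc a * real (k choose Suc a) * f (Suc a) -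
                     (-1) ^ a * real (k choose a) * f (Suc a))"
    by (subst sum.atMost_Suc_shift) (auto intro!: sum.cong simp: algebra_simps)
  also have "\<dots> = f 0 + (\<Sum>a\<le>k. (-1) ^ Suc a * real (k choose Suc a) * f (Suc a)) -
        (\<Sum>a\<le>k. (-1) ^ a * real (k choose a) * f (Suc a))"
    by (simp only: sum_subtractf add_diff_eq)
  also have "f 0 + (\<Sum>a\<le>k. (-1) ^ Suc a * real (k choose Suc a) * f (Suc a)) =
             (\<Sum>a\<le>Suc k. (-1) ^ a * real (k choose a) * f a)"
    by (simp add: sum.atMost_Suc_shift del: sum.atMost_Suc)
  also have "\<dots> = (\<Sum>a\<le>k. (-1) ^ a * real (k choose a) * f a)"
    by simp
  finally show ?thesis
    by (simp only: right_diff_distrib sum_subtractf)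
qed

text \<open>
  The \<open>k\<close>-th difference of a polynomial of degree \<open>r < k\<close>.
\<close>
lemma alternating_binomial_binomial:
  "r < k \<Longrightarrow> (\<Sum>a\<le>k. (-1) ^ a * real (k choose a) * real ((x + a) choose r)) = 0"
proof (induction k arbitrary: r)
  case (Suc k)
  show ?case
  proof (cases r)
    case 0
    then show ?thesis
      unfolding alternating_binomial_Suc by simp
  next
    case (Suc r')
    then have "(\<Sum>a\<le>Suc k. (-1) ^ a * real (Suc k choose a) * real ((x + a) choose r)) =
               - (\<Sum>a\<le>k. (-1) ^ a * real (k choose a) * real ((x + a) choose r'))"
      unfolding alternating_binomial_Suc by (simp add: sum_negf)
    with Suc.IH[of r'] Suc.prems Suc show ?thesis by simp
  qed
qed simp

lemma alternating_binomial_inverse: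
  fixes x :: real
  assumes "x > 0"
  shows "(\<Sum>a\<le>k. (-1) ^ a * real (k choose a) * (1 / (x + real a))) = fact k / pochhammer x (Suc k)"
  using assms
proof (induction k arbitrary: x)
  case (Suc k)
  have "(\<Sum>a\<le>Suc k. (-1) ^ a * real (Suc k choose a) * (1 / (x + real a))) =
        (\<Sum>a\<le>k. (-1) ^ a * real (k choose a) * (1 / (x + real a))) -
        (\<Sum>a\<le>k. (-1) ^ a * real (k choose a) * (1 / (x + 1 + real a)))"
    unfolding alternating_binomial_Suc by (simp add: right_diff_distrib sum_subtractf add_ac)
  also have "\<dots> = fact k / pochhammer x (Suc k) - fact k / pochhammer (x + 1) (Suc k)"
    using Suc by simp
  also have "pochhammer x (Suc k) = x * pochhammer (x + 1) k"
    by (rule pochhammer_rec)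
  also have "pochhammer (x + 1) (Suc k) = pochhammer (x + 1) k * (x + 1 + real k)"
    by (rule pochhammer_Suc)
  also have "fact k / (x * pochhammer (x + 1) k) - fact k / (pochhammer (x + 1) k * (x + 1 + real k)) =
             fact (Suc k) / (x * (pochhammer (x + 1) k * (x + 1 + real k)))"
    using Suc.prems pochhammer_pos[of "x + 1" k] by (simp add: divide_simps) (simp add: algebra_simps)
  also have "x * (pochhammer (x + 1) k * (x + 1 + real k)) = pochhammer x (Suc (Suc k))"
    by (simp only: pochhammer_rec[of x "Suc k"] pochhammer_Suc[of "x + 1" k])
  finally show ?case .
qed simp

text \<open>
  Both sides count the subsets of \<open>{0..n + m}\<close> with \<open>a + m + 1\<close> elements, the left one according to
  the position \<open>j + m\<close> of the \<open>(m + 1)\<close>-st smallest element.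
\<close>
lemma binomial_convolution_upper:
  "(\<Sum>j\<le>n. ((n - j) choose a) * ((j + m) choose m)) = (n + m + 1) choose (a + m + 1)"
proof (induction n arbitrary: a)
  case 0
  show ?case by (cases a) simp_all
next
  case (Suc n)
  show ?case
  proof (cases a)
    case 0
    then show ?thesis
      using choose_rising_sum(1)[of m "Suc n"] by (simp add: add_ac)
  next
    case (Suc a')
    have "(\<Sum>j\<le>Suc n. ((Suc n - j) choose a) * ((j + m) choose m)) =
          (\<Sum>j\<le>n. ((n - j) choose a') * ((j + m) choose m)) + (\<Sum>j\<le>n. ((n - j) choose a) * ((j + m) choose m))"
      using Suc by (simp add: Suc_diff_le add_mult_distrib sum.distrib)
    then show ?thesis
      unfolding Suc.IH using Suc by simp
  qed
qed

text \<open>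
  The discrete Legendre (Chebyshev) polynomial of degree \<open>k\<close> on \<open>{0..n}\<close>, that is, the Hahn polynomial
  with both parameters zero, in the variable \<open>n - j\<close>.  It is normalised to \<open>1\<close> at the level \<open>n\<close> of
  the state in which the chain starts.
\<close>
definition legendre :: "nat \<Rightarrow> nat \<Rightarrow> nat \<Rightarrow> real" where
  "legendre n k j = (\<Sum>a\<le>k. (-1) ^ a * real (k choose a) * real ((k + a) choose a) *
     (real ((n - j) choose a) / real (n choose a)))"

lemma legendre_endpoint: "legendre n k n = 1"
proof -
  have "legendre n k n = (\<Sum>a\<in>{0}. (-1) ^ a * real (k choose a) * real ((k + a) choose a) *
     (real ((n - n) choose a) / real (n choose a)))"
    unfolding legendre_def by (intro sum.mono_neutral_right) (auto simp: binomial_eq_0)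
  then show ?thesis by simp
qed

lemma legendre_0 [simp]: "legendre n 0 j = 1"
  by (simp add: legendre_def)

lemma polyfun_legendre:
  "polyfun n k (real ((2 * k) choose k) / (fact k * real (n choose k))) (legendre n k)"
proof -
  have "polyfun n k (\<Sum>a\<le>k. if a = k then real ((2 * k) choose k) / (fact k * real (n choose k)) else 0)
     (\<lambda>j. \<Sum>a\<le>k. ((-1) ^ a * real (k choose a) * real ((k + a) choose a) / real (n choose a)) * real ((n - j) choose a))"
  proof (rule polyfun_sum)
    fix a assume a: "a \<in> {..k}"
    define w where "w = (-1) ^ a * real (k choose a) * real ((k + a) choose a) / real (n choose a)"
    have pa: "polyfun n a (w * ((-1) ^ a / fact a)) (\<lambda>j. w * real ((n - j) choose a))"
      by (intro polyfun_scale polyfun_binomial_reflect)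
    show "polyfun n k (if a = k then real ((2 * k) choose k) / (fact k * real (n choose k)) else 0)
            (\<lambda>j. w * real ((n - j) choose a))"
    proof (cases "a = k")
      case True
      show ?thesis
        by (rule polyfun_cong[OF pa[unfolded True]]) (cases "even k"; auto simp: w_def mult_2 True)+
    next
      case False
      with a polyfun_mono[OF pa, of k] show ?thesis by simp
    qed
  qed simp
  then show ?thesis
    by (rule polyfun_cong) (simp_all add: legendre_def)
qed

text \<open>
  Summing over \<open>j\<close> first leaves an alternating sum over \<open>a\<close> of \<open>(k + a)! / (a + m + 1)!\<close>.  For
  \<open>m < k\<close> this is a polynomial in \<open>a\<close> of degree \<open>k - m - 1\<close>, annihilated by the \<open>k\<close>-th difference; for
  \<open>m = k\<close> it is \<open>1 / (k + a + 1)\<close>.  The test functions \<open>(j + m choose m)\<close> are chosen because they form a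
  convolution pair with \<open>(n - j choose a)\<close>.
\<close>
lemma inner_legendre_rising:
  assumes "m \<le> k" "k \<le> n"
  shows "inner n (legendre n k) (\<lambda>j. real ((j + m) choose m)) =
         (if m = k then fact (n + k + 1) * fact k / (fact n * fact (2 * k + 1)) else 0)"
proof -
  have "inner n (legendre n k) (\<lambda>j. real ((j + m) choose m)) =
        (\<Sum>j\<le>n. \<Sum>a\<le>k. (-1) ^ a * real (k choose a) * real ((k + a) choose a) / real (n choose a) *
           real (((n - j) choose a) * ((j + m) choose m)))"
    unfolding inner_def legendre_def sum_distrib_right
    by (intro sum.cong refl) (simp add: mult_ac)
  also have "\<dots> = (\<Sum>a\<le>k. (-1) ^ a * real (k choose a) * real ((k + a) choose a) / real (n choose a) *
           real (\<Sum>j\<le>n. ((n - j) choose a) * ((j + m) choose m)))"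
    unfolding of_nat_sum sum_distrib_left by (rule sum.swap)
  also have "\<dots> = (\<Sum>a\<le>k. (-1) ^ a * real (k choose a) *
             (fact (n + m + 1) / (fact n * fact k) * (fact (k + a) / fact (a + m + 1))))"
    unfolding binomial_convolution_upper
  proof (intro sum.cong refl)
    fix a assume "a \<in> {..k}"
    then have "a \<le> n" using assms by simp
    then have "real ((n + m + 1) choose (a + m + 1)) = fact (n + m + 1) / (fact (a + m + 1) * fact (n - a))"
      by (subst binomial_fact) auto
    moreover have "real ((k + a) choose a) = fact (k + a) / (fact a * fact k)"
      by (subst binomial_fact) auto
    moreover have "real (n choose a) = fact n / (fact a * fact (n - a))"
      using \<open>a \<le> n\<close> by (rule binomial_fact)
    ultimately show "(-1) ^ a * real (k choose a) * real ((k + a) choose a) / real (n choose a) *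
           real ((n + m + 1) choose (a + m + 1)) = (-1) ^ a * real (k choose a) *
             (fact (n + m + 1) / (fact n * fact k) * (fact (k + a) / fact (a + m + 1)))"
      by (simp only:) (simp add: field_simps del: fact_Suc)
  qed
  also have "\<dots> = fact (n + m + 1) / (fact n * fact k) *
      (\<Sum>a\<le>k. (-1) ^ a * real (k choose a) * (fact (k + a) / fact (a + m + 1)))"
    by (simp add: sum_distrib_left mult_ac)
  also have "\<dots> = (if m = k then fact (n + k + 1) * fact k / (fact n * fact (2 * k + 1)) else 0)"
  proof (cases "m = k")
    case True
    have "(\<Sum>a\<le>k. (-1) ^ a * real (k choose a) * (fact (k + a) / fact (a + m + 1))) =
          (\<Sum>a\<le>k. (-1) ^ a * real (k choose a) * (1 / (real (k + 1) + real a)))"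
    proof (intro sum.cong refl)
      fix a
      have "fact (a + m + 1) = (real (k + 1) + real a) * fact (k + a)"
        using fact_Suc[of "k + a", where 'a = real] True by (simp add: add_ac)
      then show "(-1) ^ a * real (k choose a) * (fact (k + a) / fact (a + m + 1)) =
                 (-1) ^ a * real (k choose a) * (1 / (real (k + 1) + real a))"
        by simp
    qed
    also have "\<dots> = fact k / pochhammer (1 + real k) (Suc k)"
      by (subst alternating_binomial_inverse) (simp_all add: add_ac)
    also have "\<dots> = fact k * fact k / fact (2 * k + 1)"
    proof -
      have "fact (2 * k + 1) = fact k * pochhammer (1 + real k) (Suc k)"
        using pochhammer_product'[of "1 :: real" k "Suc k"]
        by (simp add: mult_2 del: fact_Suc flip: pochhammer_fact)
      then show ?thesis by (simp only:) simp
    qed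
    finally show ?thesis using True by simp
  next
    case False
    then have "m < k" using assms by simp
    have "(\<Sum>a\<le>k. (-1) ^ a * real (k choose a) * (fact (k + a) / fact (a + m + 1))) =
          fact (k - m - 1) * (\<Sum>a\<le>k. (-1) ^ a * real (k choose a) * real ((k + a) choose (k - m - 1)))"
      unfolding sum_distrib_left
    proof (intro sum.cong refl)
      fix a
      have "real ((k + a) choose (k - m - 1)) = fact (k + a) / (fact (k - m - 1) * fact (a + m + 1))"
        using \<open>m < k\<close> by (subst binomial_fact) (auto simp: add_ac)
      then show "(-1) ^ a * real (k choose a) * (fact (k + a) / fact (a + m + 1)) =
        fact (k - m - 1) * ((-1) ^ a * real (k choose a) * real ((k + a) choose (k - m - 1)))"
        by (simp del: fact_Suc)
    qed
    then show ?thesis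
      using False \<open>m < k\<close> by (simp add: alternating_binomial_binomial)
  qed
  finally show ?thesis .
qed

lemma inner_legendre_lower_degree:
  assumes "polyfun n d \<alpha> f" "d < k" "k \<le> n"
  shows "inner n (legendre n k) f = 0"
  using assms(1)
proof (induction rule: polyfun_basis_induct[where \<beta> = "\<lambda>m. 1 / fact m" and b = "\<lambda>m j. real ((j + m) choose m)"])
  case (basis m)
  then show ?case
    using assms(2,3) by (simp add: polyfun_rising inner_legendre_rising)
next
  case (zero f)
  then show ?case by (simp add: inner_def)
next
  case (combine f g c)
  then show ?case by (simp add: inner_add_right inner_scale_right)
qed

definition legendre_sqnorm :: "nat \<Rightarrow> nat \<Rightarrow> real" where
  "legendre_sqnorm n k = fact (n - k) * fact (n + k + 1) / (fact n ^ 2 * real (2 * k + 1))"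

text \<open>
  For the norm, one of the two factors may be replaced by the multiple of \<open>(j + k choose k)\<close> with the same
  leading coefficient, as the difference has lower degree.
\<close>
lemma inner_legendre:
  assumes "k \<le> n" "m \<le> n"
  shows "inner n (legendre n k) (legendre n m) = (if k = m then legendre_sqnorm n k else 0)"
proof -
  have less: "inner n (legendre n k) (legendre n m) = 0" if "m < k" "k \<le> n" for k m
    using inner_legendre_lower_degree[OF polyfun_legendre that] .
  have self: "inner n (legendre n k) (legendre n k) = legendre_sqnorm n k"
  proof -
    define \<alpha> where "\<alpha> = real ((2 * k) choose k) / (fact k * real (n choose k))"
    define g where "g = (\<lambda>j. legendre n k j - \<alpha> * fact k * real ((j + k) choose k))"
    have "polyfun n k (\<alpha> - \<alpha> * fact k * (1 / fact k)) g"
      unfolding g_def \<alpha>_def by (intro polyfun_diff polyfun_scale polyfun_legendre polyfun_rising)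
    then have g: "polyfun n k 0 g" by simp
    have "inner n (legendre n k) g = 0"
    proof (cases k)
      case 0
      with g show ?thesis
        by (simp add: inner_def polyfun_0_0D)
    next
      case (Suc k')
      with g obtain \<beta> where "polyfun n k' \<beta> g"
        using polyfun_Suc_0D by blast
      then show ?thesis
        using Suc assms(1) by (intro inner_legendre_lower_degree) auto
    qed
    then have "inner n (legendre n k) (legendre n k) =
               \<alpha> * fact k * inner n (legendre n k) (\<lambda>j. real ((j + k) choose k))"
      unfolding g_def inner_diff_right inner_scale_right by simp
    also have "\<dots> = \<alpha> * fact k * (fact (n + k + 1) * fact k / (fact n * fact (2 * k + 1)))"
      using assms by (simp add: inner_legendre_rising)
    also have "\<dots> = legendre_sqnorm n k"
    proof -
      have "\<alpha> * fact k = fact (2 * k) * fact (n - k) / (fact k * fact n)"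
        using assms(1) by (simp add: \<alpha>_def binomial_fact mult_2)
      moreover have "fact (2 * k + 1) = real (2 * k + 1) * fact (2 * k)"
        by (simp only: fact_Suc Suc_eq_plus1[symmetric])
      ultimately show ?thesis
        by (simp only: legendre_sqnorm_def power2_eq_square) (simp add: mult_ac del: of_nat_Suc of_nat_add of_nat_mult fact_Suc)
    qed
    finally show ?thesis .
  qed
  show ?thesis
    using less[of m k] less[of k m] self assms by (cases k m rule: linorder_cases) (auto simp: inner_commute)
qed

text \<open>
  Because the polynomials are \<open>1\<close> at the level \<open>n\<close>, the reciprocal norm is the weight of the \<open>k\<close>-th
  eigenfunction in the expansion of the starting distribution; this lemma bounds it by \<open>(2k + 1) / (n + 1)\<close>.
\<close>
lemma legendre_sqnorm_ge: "k \<le> n \<Longrightarrow> real (n + 1) / real (2 * k + 1) \<le> legendre_sqnorm n k"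
proof -
  assume "k \<le> n"
  then have "fact n * fact (n + 1) \<le> (fact (n - k) * fact (n + k + 1) :: real)"
  proof (induction k)
    case (Suc k)
    have "fact n * fact (n + 1) \<le> (fact (n - k) * fact (n + k + 1) :: real)"
      using Suc by simp
    also have "n - k = Suc (n - Suc k)"
      using Suc.prems by simp
    also have "fact (Suc (n - Suc k)) * fact (n + k + 1) = real (n - k) * (fact (n - Suc k) * fact (n + k + 1))"
      using Suc.prems by (simp add: of_nat_diff del: fact_Suc) (simp add: of_nat_diff algebra_simps)
    also have "\<dots> \<le> real (n + k + 2) * (fact (n - Suc k) * fact (n + k + 1))"
      by (intro mult_right_mono) auto
    also have "\<dots> = fact (n - Suc k) * fact (n + Suc k + 1)"
      by simp
    finally show ?case .
  qed simp
  then have "real (n + 1) * fact n ^ 2 \<le> fact (n - k) * fact (n + k + 1)"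
    by (simp add: power2_eq_square algebra_simps)
  then have "real (n + 1) \<le> fact (n - k) * fact (n + k + 1) / fact n ^ 2"
    by (subst pos_le_divide_eq) simp_all
  then show ?thesis
    unfolding legendre_sqnorm_def divide_divide_eq_left[symmetric] by (rule divide_right_mono) simp
qed

lemma legendre_sqnorm_pos: "legendre_sqnorm n k > 0"
  by (simp add: legendre_sqnorm_def)

lemma legendre_sqnorm_0: "legendre_sqnorm n 0 = real (n + 1)"
  by (simp add: legendre_sqnorm_def power2_eq_square)

section \<open>Spectral expansion from the top level\<close>

text \<open>
  The difference of the two sides has degree below \<open>k\<close>.  It is orthogonal to all such polynomials, since
  the operator is symmetric and does not raise degrees; hence it is orthogonal to itself.
\<close>
lemma lumped_op_legendre:
  assumes "k \<le> n" "j \<le> n"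
  shows "lumped_op n (legendre n k) j = eigenvalue k * legendre n k j"
proof -
  define \<alpha> where "\<alpha> = real ((2 * k) choose k) / (fact k * real (n choose k))"
  define g where "g = (\<lambda>j. lumped_op n (legendre n k) j - eigenvalue k * legendre n k j)"
  have "polyfun n k (eigenvalue k * \<alpha> - eigenvalue k * \<alpha>) g"
    unfolding g_def \<alpha>_def by (intro polyfun_diff polyfun_scale polyfun_lumped_op polyfun_legendre)
  then have g: "polyfun n k 0 g" by simp
  have "inner n g g = 0"
  proof (cases k)
    case 0
    with g show ?thesis
      by (simp add: inner_def polyfun_0_0D)
  next
    case (Suc k')
    with g obtain \<beta> where \<beta>: "polyfun n k' \<beta> g"
      using polyfun_Suc_0D by blast
    have "inner n (lumped_op n (legendre n k)) g = 0" "inner n (legendre n k) g = 0"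
      using inner_legendre_lower_degree[OF polyfun_lumped_op[OF \<beta>], of k]
        inner_legendre_lower_degree[OF \<beta>, of k] Suc assms(1) by (simp_all add: inner_lumped_op_left)
    then have "inner n g (\<lambda>j. lumped_op n (legendre n k) j - eigenvalue k * legendre n k j) = 0"
      unfolding inner_diff_right inner_scale_right by (simp add: inner_commute)
    then show ?thesis by (simp add: g_def)
  qed
  from inner_self_eq_0D[OF this assms(2)] show ?thesis by (simp add: g_def)
qed

text \<open>
  The point mass at the level \<open>n\<close>, in a form that is visibly a polynomial of degree \<open>n\<close>.
\<close>
definition point_mass :: "nat \<Rightarrow> nat \<Rightarrow> real" where
  "point_mass n j = real (j choose n)"

lemma point_mass_eq: "j \<le> n \<Longrightarrow> point_mass n j = (if j = n then 1 else 0)"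
  by (simp add: point_mass_def)

lemma inner_point_mass: "inner n f (point_mass n) = f n"
proof -
  have "inner n f (point_mass n) = (\<Sum>j\<le>n. if j = n then f j else 0)"
    unfolding inner_def by (intro sum.cong) (simp_all add: point_mass_eq)
  then show ?thesis by simp
qed

text \<open>
  The difference is a polynomial function of degree at most \<open>n\<close> which is orthogonal to all Legendre
  polynomials of degree at most \<open>n\<close>, and these span.
\<close>
lemma point_mass_expansion:
  assumes "j \<le> n"
  shows "point_mass n j = (\<Sum>k\<le>n. 1 / legendre_sqnorm n k * legendre n k j)"
proof -
  define g where "g = (\<lambda>j. point_mass n j - (\<Sum>k\<le>n. 1 / legendre_sqnorm n k * legendre n k j))"
  have orth: "inner n g (legendre n m) = 0" if "m \<le> n" for m
  proof -
    have "inner n (legendre n m) g =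
      1 - (\<Sum>k\<le>n. 1 / legendre_sqnorm n k * (if m = k then legendre_sqnorm n m else 0))"
      unfolding g_def inner_diff_right inner_sum_right inner_scale_right
      using that by (simp add: inner_point_mass legendre_endpoint inner_legendre)
    also have "\<dots> = 1 - (\<Sum>k\<le>n. if m = k then 1 else 0)"
      using legendre_sqnorm_pos[of n] by (intro arg_cong2[where f = "(-)"] refl sum.cong) (auto simp: less_imp_neq[symmetric])
    also have "\<dots> = 0"
      using that by simp
    finally show ?thesis by (simp add: inner_commute)
  qed
  have point_mass: "polyfun n n (1 / fact n) (point_mass n)"
    using polyfun_binomial[of n n] by (simp add: point_mass_def[abs_def])
  have "\<exists>\<alpha>. polyfun n n \<alpha> (\<lambda>j. 1 / legendre_sqnorm n k * legendre n k j)" if "k \<le> n" for k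
  proof (cases "k = n")
    case True
    then show ?thesis using polyfun_scale polyfun_legendre by blast
  next
    case False
    then show ?thesis using that polyfun_mono polyfun_scale polyfun_legendre le_neq_implies_less by meson
  qed
  then obtain \<alpha> where "\<And>k. k \<le> n \<Longrightarrow> polyfun n n (\<alpha> k) (\<lambda>j. 1 / legendre_sqnorm n k * legendre n k j)"
    by metis
  then have "polyfun n n (1 / fact n - (\<Sum>k\<le>n. \<alpha> k)) g"
    unfolding g_def by (intro polyfun_diff point_mass polyfun_sum) auto
  moreover have "polyfun n n \<beta> f \<Longrightarrow> inner n g f = 0" for f \<beta>
  proof (induction rule: polyfun_basis_induct[where b = "legendre n" and
       \<beta> = "\<lambda>k. real ((2 * k) choose k) / (fact k * real (n choose k))" ])
    case (basis k)
    then show ?case by (simp add: polyfun_legendre orth)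
  next
    case (zero f)
    then show ?case by (simp add: inner_def)
  next
    case (combine f h c)
    then show ?case by (simp add: inner_add_right inner_scale_right)
  qed
  ultimately have "inner n g g = 0" by blast
  from inner_self_eq_0D[OF this assms] show ?thesis by (simp add: g_def)
qed

lemma lumped_op_power_point_mass:
  "j \<le> n \<Longrightarrow> (lumped_op n ^^ l) (point_mass n) j = (\<Sum>k\<le>n. eigenvalue k ^ l / legendre_sqnorm n k * legendre n k j)"
proof (induction l arbitrary: j)
  case 0
  then show ?case by (simp add: point_mass_expansion)
next
  case (Suc l)
  have "(lumped_op n ^^ Suc l) (point_mass n) j =
        lumped_op n (\<lambda>j. \<Sum>k\<le>n. eigenvalue k ^ l / legendre_sqnorm n k * legendre n k j) j"
    unfolding funpow.simps comp_def by (rule lumped_op_cong) (use Suc in auto)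
  also have "\<dots> = (\<Sum>k\<le>n. eigenvalue k ^ l / legendre_sqnorm n k * (eigenvalue k * legendre n k j))"
    unfolding lumped_op_sum[OF finite_atMost] lumped_op_scale
    using Suc.prems by (simp add: lumped_op_legendre)
  finally show ?case by (simp add: mult_ac)
qed

text \<open>
  By symmetry of the transition matrix, applying the operator \<open>l\<close> times to a point mass yields the
  \<open>l\<close>-step distribution from that point, so this is its total variation distance from the uniform one.
\<close>
definition lumped_distance :: "nat \<Rightarrow> nat \<Rightarrow> real" where
  "lumped_distance n l = 1 / 2 * (\<Sum>j\<le>n. \<bar>(lumped_op n ^^ l) (point_mass n) j - 1 / real (n + 1)\<bar>)"

lemma inner_deviation_legendre:
  assumes "1 \<le> k" "k \<le> n"
  shows "inner n (legendre n k) (\<lambda>j. (lumped_op n ^^ l) (point_mass n) j - 1 / real (n + 1)) = eigenvalue k ^ l"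
proof -
  have "inner n (legendre n k) (\<lambda>j. (lumped_op n ^^ l) (point_mass n) j - 1 / real (n + 1)) =
        inner n (legendre n k) (\<lambda>j. (\<Sum>m\<le>n. eigenvalue m ^ l / legendre_sqnorm n m * legendre n m j) - 1 / real (n + 1) * legendre n 0 j)"
    by (rule inner_cong) (simp_all add: lumped_op_power_point_mass)
  also have "\<dots> = (\<Sum>m\<le>n. eigenvalue m ^ l / legendre_sqnorm n m * (if k = m then legendre_sqnorm n k else 0))"
    unfolding inner_diff_right inner_sum_right inner_scale_right
    using assms inner_legendre[of k n 0] by (simp add: inner_legendre del: legendre_0)
  also have "\<dots> = (\<Sum>m\<le>n. if k = m then eigenvalue k ^ l else 0)"
    using legendre_sqnorm_pos[of n] by (intro sum.cong) (auto simp: less_imp_neq[symmetric])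
  finally show ?thesis using assms by simp
qed

lemma inner_deviation_self:
  "inner n (\<lambda>j. (lumped_op n ^^ l) (point_mass n) j - 1 / real (n + 1)) (\<lambda>j. (lumped_op n ^^ l) (point_mass n) j - 1 / real (n + 1)) =
   (\<Sum>k=1..n. eigenvalue k ^ (2 * l) / legendre_sqnorm n k)"
proof -
  define g where "g = (\<lambda>j. (lumped_op n ^^ l) (point_mass n) j - 1 / real (n + 1))"
  have g: "g j = (\<Sum>k=1..n. eigenvalue k ^ l / legendre_sqnorm n k * legendre n k j)" if "j \<le> n" for j
  proof -
    have "{..n} = insert 0 {1..n}" by auto
    then show ?thesis
      using that by (simp add: g_def lumped_op_power_point_mass legendre_sqnorm_0)
  qed
  have "inner n g g = inner n g (\<lambda>j. \<Sum>k=1..n. eigenvalue k ^ l / legendre_sqnorm n k * legendre n k j)"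
    by (rule inner_cong) (simp_all add: g)
  also have "\<dots> = (\<Sum>k=1..n. eigenvalue k ^ l / legendre_sqnorm n k * inner n (legendre n k) g)"
    unfolding inner_sum_right inner_scale_right by (simp only: inner_commute)
  also have "\<dots> = (\<Sum>k=1..n. eigenvalue k ^ (2 * l) / legendre_sqnorm n k)"
  proof (intro sum.cong refl)
    fix k assume "k \<in> {1..n}"
    then have "inner n (legendre n k) g = eigenvalue k ^ l"
      unfolding g_def by (intro inner_deviation_legendre) auto
    then show "eigenvalue k ^ l / legendre_sqnorm n k * inner n (legendre n k) g = eigenvalue k ^ (2 * l) / legendre_sqnorm n k"
      by (simp add: mult_2 power_add)
  qed
  finally show ?thesis unfolding g_def .
qed

section \<open>Bounds for the chain on levels\<close>

text \<open>
  In terms of \<open>u = n - j\<close> the polynomial is \<open>1 - 6 u (n - u) / (n (n - 1))\<close>, and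
  \<open>u (n - u) \<le> n\<^sup>2 / 4 \<le> n (n - 1) / 2\<close> since \<open>n \<ge> 2\<close>.
\<close>
lemma abs_legendre_2_le:
  assumes "n \<ge> 2" "j \<le> n"
  shows "\<bar>legendre n 2 j\<bar> \<le> 2"
proof -
  define u where "u = real (n - j)"
  define N where "N = real n"
  have N: "N \<ge> 2" and u: "0 \<le> u" "u \<le> N" 
    using assms by (auto simp: u_def N_def)
  have choose2: "real (m choose 2) = real m * (real m - 1) / 2" for m
    using binomial_Suc_right[of m 1] by (simp add: numeral_2_eq_2)
  have "(4::nat) choose 2 = 6"
    by (simp add: choose_two)
  moreover have "{..2} = {0, 1, 2::nat}" by auto
  ultimately have "legendre n 2 j = 1 - 6 * u / N + 6 * (u * (u - 1)) / (N * (N - 1))"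
    unfolding legendre_def by (simp add: choose2 u_def N_def)
  also have "\<dots> = 1 - 6 * (u * (N - u) / (N * (N - 1)))"
    using N by (simp add: divide_simps) (simp add: algebra_simps)
  finally have eq: "legendre n 2 j = 1 - 6 * (u * (N - u) / (N * (N - 1)))" .
  have "u * (N - u) \<le> 1 / 2 * (N * (N - 1))"
  proof -
    have "0 \<le> (u - N / 2) ^ 2" by simp
    moreover have "0 \<le> N * (N - 2)" using N by simp
    ultimately show ?thesis by (simp add: power2_eq_square algebra_simps)
  qed
  then have "u * (N - u) / (N * (N - 1)) \<le> 1 / 2"
    using N by (simp add: pos_divide_le_eq)
  moreover have "0 \<le> u * (N - u) / (N * (N - 1))"
    using N u by simp
  ultimately show ?thesis unfolding eq by linarith
qed

text \<open>
  The degree-two Legendre polynomial has mean zero and is an eigenfunction for \<open>1/4\<close>, so its mean after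
  \<open>l\<close> steps is exactly \<open>(1/4)\<^sup>l\<close>.
\<close>
lemma lumped_distance_ge:
  assumes "n \<ge> 2"
  shows "1 / 4 * (1 / 4) ^ l \<le> lumped_distance n l"
proof -
  let ?g = "\<lambda>j. (lumped_op n ^^ l) (point_mass n) j - 1 / real (n + 1)"
  have "(1 / 4) ^ l = inner n (legendre n 2) ?g"
    using inner_deviation_legendre[of 2 n l] assms by (simp add: eigenvalue_2)
  also have "\<dots> \<le> (\<Sum>j\<le>n. 2 * \<bar>?g j\<bar>)"
    unfolding inner_def
  proof (intro sum_mono)
    fix j assume "j \<in> {..n}"
    have "legendre n 2 j * ?g j \<le> \<bar>legendre n 2 j\<bar> * \<bar>?g j\<bar>"
      by (simp flip: abs_mult)
    also have "\<dots> \<le> 2 * \<bar>?g j\<bar>"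
      using abs_legendre_2_le[OF assms, of j] \<open>j \<in> {..n}\<close> by (intro mult_right_mono) auto
    finally show "legendre n 2 j * ?g j \<le> 2 * \<bar>?g j\<bar>" .
  qed
  also have "\<dots> = 4 * lumped_distance n l"
    by (simp add: lumped_distance_def sum_distrib_left)
  finally show ?thesis by simp
qed

lemma lumped_distance_le_1: "lumped_distance n l \<le> 1"
proof -
  let ?h = "(lumped_op n ^^ l) (point_mass n)"
  have nonneg: "?h j \<ge> 0" if "j \<le> n" for j
    using that
  proof (induction l arbitrary: j)
    case 0
    then show ?case by (simp add: point_mass_def)
  qed (simp add: lumped_op_nonneg)
  have "(\<Sum>j\<le>n. ?h j) = inner n (legendre n 0) ?h"
    by (simp add: inner_def)
  also have "\<dots> = inner n (legendre n 0) (\<lambda>j. \<Sum>k\<le>n. eigenvalue k ^ l / legendre_sqnorm n k * legendre n k j)"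
    by (rule inner_cong) (simp_all add: lumped_op_power_point_mass)
  also have "\<dots> = (\<Sum>k\<le>n. eigenvalue k ^ l / legendre_sqnorm n k * (if 0 = k then legendre_sqnorm n 0 else 0))"
    unfolding inner_sum_right inner_scale_right by (simp add: inner_legendre)
  also have "\<dots> = (\<Sum>k\<le>n. if 0 = k then 1 else 0)"
    by (intro sum.cong) (auto simp: legendre_sqnorm_0)
  finally have "(\<Sum>j\<le>n. ?h j) = 1" by simp
  moreover have "(\<Sum>j\<le>n. \<bar>?h j - 1 / real (n + 1)\<bar>) \<le> (\<Sum>j\<le>n. ?h j + 1 / real (n + 1))"
    by (intro sum_mono) (use nonneg in \<open>auto simp: abs_le_iff intro: order_trans[of _ 0]\<close>)
  ultimately show ?thesis
    by (simp add: lumped_distance_def sum.distrib)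
qed

text \<open>
  The first term vanishes and, for \<open>k \<ge> 2\<close>, the bound \<open>\<beta>\<^sub>k \<le> 1/(k + 2)\<close> makes the terms at most
  \<open>2/(k + 2)\<^sup>3\<close>, which is dominated by a telescoping series.
\<close>
lemma sum_eigenvalue_power_4_le: "(\<Sum>k=1..n. real (2 * k + 1) * eigenvalue k ^ 4) \<le> 1 / 4"
proof -
  have "(\<Sum>k=1..n. real (2 * k + 1) * eigenvalue k ^ 4) \<le> 1 / 4 - 1 / (2 * (real n + 2))"
  proof (induction n)
    case 0
    show ?case by simp
  next
    case (Suc n)
    show ?case
    proof (cases "n = 0")
      case True
      then show ?thesis by (simp add: eigenvalue_eq)
    next
      case False
      define x where "x = real n + 3"
      have x: "x \<ge> 4" using False by (simp add: x_def)
      have "real (2 * Suc n + 1) * eigenvalue (Suc n) ^ 4 \<le> (2 * x) * (1 / x) ^ 4"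
        using eigenvalue_bounds[of "Suc n"] by (intro mult_mono power_mono) (auto simp: x_def add_ac)
      also have "\<dots> = 2 / x ^ 3"
        using x by (simp add: power_divide power4_eq_xxxx power3_eq_cube)
      also have "\<dots> \<le> 1 / (2 * x * (x - 1))"
      proof -
        have "2 * (2 * x * (x - 1)) \<le> 4 * (x * x)"
          using x by (simp add: algebra_simps)
        also have "\<dots> \<le> x * (x * x)"
          using x by (intro mult_right_mono) auto
        finally have "2 * (2 * x * (x - 1)) \<le> 1 * x ^ 3"
          by (simp add: power3_eq_cube mult_ac)
        then show ?thesis
          using x by (intro frac_le_eq[THEN iffD2]) (auto simp: field_simps)
      qed
      also have "\<dots> = 1 / (2 * (x - 1)) - 1 / (2 * x)"
        using x by (simp add: field_simps)
      finally show ?thesis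
        using Suc by (simp add: x_def add_ac)
    qed
  qed
  also have "\<dots> \<le> 1 / 4" by simp
  finally show ?thesis .
qed

text \<open>
  The case \<open>l = 1\<close> must be separated: there the spectral sum is of order \<open>ln n\<close>, but the claimed bound is \<open>1\<close>.
\<close>
lemma lumped_distance_le:
  assumes "l \<ge> 1"
  shows "lumped_distance n l \<le> 4 * (1 / 4) ^ l"
proof (cases "l = 1")
  case True
  then show ?thesis using lumped_distance_le_1[of n l] by simp
next
  case False
  then obtain q where l: "l = q + 2"
    using assms that[of "l - 2"] by simp
  define g where "g = (\<lambda>j. (lumped_op n ^^ l) (point_mass n) j - 1 / real (n + 1))"
  \<comment> \<open>The target for the sum of the deviations, namely \<open>8 (1/4)\<^sup>l\<close>.\<close>
  define c where "c = (1 / 4 :: real) ^ q * (1 / 2)"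
  have "c > 0" by (simp add: c_def)
  have "real (n + 1) * inner n g g = (\<Sum>k=1..n. real (n + 1) * (eigenvalue k ^ (2 * l) / legendre_sqnorm n k))"
    unfolding g_def inner_deviation_self sum_distrib_left ..
  also have "\<dots> \<le> (\<Sum>k=1..n. (1 / 4) ^ (2 * q) * (real (2 * k + 1) * eigenvalue k ^ 4))"
  proof (rule sum_mono)
    fix k assume k: "k \<in> {1..n}"
    note eigenvalue = eigenvalue_bounds[of k]
    have "real (n + 1) / legendre_sqnorm n k \<le> real (2 * k + 1)"
      using legendre_sqnorm_ge[of k n] k legendre_sqnorm_pos[of n k]
      by (simp add: pos_divide_le_eq mult.commute del: of_nat_add of_nat_Suc of_nat_mult)
    moreover have "eigenvalue k ^ (2 * q) \<le> (1 / 4) ^ (2 * q)"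
      using eigenvalue k by (intro power_mono) auto
    then have "eigenvalue k ^ (2 * q) * eigenvalue k ^ 4 \<le> (1 / 4) ^ (2 * q) * eigenvalue k ^ 4"
      using eigenvalue k by (intro mult_right_mono) auto
    moreover have "eigenvalue k ^ (2 * l) = eigenvalue k ^ (2 * q) * eigenvalue k ^ 4"
      by (simp only: l add_mult_distrib2 power_add) simp
    ultimately have "real (n + 1) / legendre_sqnorm n k * eigenvalue k ^ (2 * l) \<le>
                     real (2 * k + 1) * ((1 / 4) ^ (2 * q) * eigenvalue k ^ 4)"
      using eigenvalue k by (intro mult_mono) (simp_all del: of_nat_add of_nat_mult)
    then show "real (n + 1) * (eigenvalue k ^ (2 * l) / legendre_sqnorm n k) \<le> (1 / 4) ^ (2 * q) * (real (2 * k + 1) * eigenvalue k ^ 4)"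
      by (simp add: mult_ac)
  qed
  also have "\<dots> \<le> (1 / 4) ^ (2 * q) * (1 / 4)"
    unfolding sum_distrib_left[symmetric] by (intro mult_left_mono sum_eigenvalue_power_4_le) auto
  also have "\<dots> = c * c"
    by (simp add: c_def mult_2 power_add)
  finally have l2: "real (n + 1) * inner n g g \<le> c * c" .
  \<comment> \<open>The Cauchy-Schwarz inequality for \<open>\<bar>g\<bar>\<close> and a constant, as a weighted mean inequality in each term.\<close>
  have "c * (\<Sum>j\<le>n. \<bar>g j\<bar>) \<le> (\<Sum>j\<le>n. (real (n + 1) * (g j * g j) + c * c / real (n + 1)) / 2)"
    unfolding sum_distrib_left
  proof (rule sum_mono)
    fix j
    define N where "N = real (n + 1)"
    have "N > 0" by (simp add: N_def)
    have "0 \<le> (N * \<bar>g j\<bar> - c)\<^sup>2 / N"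
      using \<open>N > 0\<close> by simp
    also have "\<dots> = N * (\<bar>g j\<bar> * \<bar>g j\<bar>) + c * c / N - 2 * (c * \<bar>g j\<bar>)"
      using \<open>N > 0\<close> by (simp add: power2_eq_square divide_simps del: abs_mult_self_eq) (simp add: algebra_simps del: abs_mult_self_eq)
    finally show "c * \<bar>g j\<bar> \<le> (real (n + 1) * (g j * g j) + c * c / real (n + 1)) / 2"
      by (simp add: N_def)
  qed
  also have "\<dots> = (real (n + 1) * inner n g g + real (n + 1) * (c * c / real (n + 1))) / 2"
    unfolding inner_def sum_divide_distrib[symmetric] sum.distrib sum_distrib_left[symmetric] by simp
  also have "\<dots> = (real (n + 1) * inner n g g + c * c) / 2"
    by (simp del: of_nat_add of_nat_Suc)
  also have "\<dots> \<le> c * c"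
    using l2 by simp
  finally have "(\<Sum>j\<le>n. \<bar>g j\<bar>) \<le> c"
    using \<open>c > 0\<close> by simp
  then show ?thesis
    by (simp add: lumped_distance_def g_def c_def l)
qed

section \<open>Permutations preserving a labelling\<close>

definition label_perms :: "'a set \<Rightarrow> ('a \<Rightarrow> 'c) \<Rightarrow> ('a \<Rightarrow> 'a) set" where
  "label_perms A k = {p. p permutes A \<and> (\<forall>i\<in>A. k (p i) = k i)}"

text \<open>
  A weighted count of the label-preserving permutations, where the hypotheses say that \<open>F\<close> behaves like
  \<open>t\<close> to the number of cycles: a new point either forms a cycle of its own, contributing \<open>t\<close>, or is inserted
  into the cycle of an old point \<open>b\<close>, which must have the same label.  A block with \<open>m\<close> points thus contributes
  \<open>t (t + 1) \<cdots> (t + m - 1)\<close>.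
\<close>
lemma sum_label_perms:
  fixes F :: "'a set \<Rightarrow> ('a \<Rightarrow> 'a) \<Rightarrow> real" and k :: "'a \<Rightarrow> 'c"
  assumes F_empty: "F {} id = 1"
    and F_fixed: "\<And>A a p. finite A \<Longrightarrow> a \<notin> A \<Longrightarrow> p permutes A \<Longrightarrow> F (insert a A) p = t * F A p"
    and F_join: "\<And>A a b p. finite A \<Longrightarrow> a \<notin> A \<Longrightarrow> p permutes A \<Longrightarrow> b \<in> A \<Longrightarrow>
                   F (insert a A) (transpose a b \<circ> p) = F A p"
    and "finite A" "finite V" "k ` A \<subseteq> V"
  shows "(\<Sum>p\<in>label_perms A k. F A p) = (\<Prod>v\<in>V. pochhammer t (card {i \<in> A. k i = v}))"
  using \<open>finite A\<close> \<open>k ` A \<subseteq> V\<close>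
proof (induction A rule: finite_induct)
  case empty
  have "label_perms {} k = {id}"
    by (auto simp: label_perms_def)
  then show ?case
    using F_empty by (simp add: id_def)
next
  case (insert a A)
  define S where "S = (\<Sum>p\<in>label_perms A k. F A p)"
  have preserve: "(\<forall>i\<in>insert a A. k ((transpose a b \<circ> q) i) = k i) \<longleftrightarrow> k b = k a \<and> (\<forall>i\<in>A. k (q i) = k i)"
    if q: "q permutes A" and b: "b \<in> insert a A" for q b
  proof -
    have qa: "q a = a"
      using q insert.hyps(2) by (auto simp: permutes_def)
    have swap: "k (transpose a b i) = k i" if "k b = k a" for i
      using that by (auto simp: transpose_def)
    show ?thesis
      using swap qa by (auto simp: transpose_apply_first)
  qed
  have "(\<Sum>p\<in>label_perms (insert a A) k. F (insert a A) p) =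
        (\<Sum>p\<in>{p. p permutes insert a A}. if \<forall>i\<in>insert a A. k (p i) = k i then F (insert a A) p else 0)"
    unfolding label_perms_def
    by (rule sum.mono_neutral_cong_left) (use insert.hyps in \<open>auto intro: finite_permutations\<close>)
  also have "\<dots> = (\<Sum>b\<in>insert a A. \<Sum>q\<in>{p. p permutes A}.
      if \<forall>i\<in>insert a A. k ((transpose a b \<circ> q) i) = k i then F (insert a A) (transpose a b \<circ> q) else 0)"
    by (rule sum_over_permutations_insert[OF insert.hyps])
  also have "\<dots> = (\<Sum>b\<in>insert a A. (if b = a then t else if k b = k a then 1 else 0) * S)"
  proof (intro sum.cong refl)
    fix b assume b: "b \<in> insert a A"
    have "(\<Sum>q\<in>{p. p permutes A}.
             if \<forall>i\<in>insert a A. k ((transpose a b \<circ> q) i) = k i then F (insert a A) (transpose a b \<circ> q) else 0) =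
          (\<Sum>q\<in>{p. p permutes A}. (if b = a then t else if k b = k a then 1 else 0) *
             (if \<forall>i\<in>A. k (q i) = k i then F A q else 0))"
    proof (intro sum.cong refl)
      fix q assume "q \<in> {p. p permutes A}"
      then have q: "q permutes A" by simp
      show "(if \<forall>i\<in>insert a A. k ((transpose a b \<circ> q) i) = k i then F (insert a A) (transpose a b \<circ> q) else 0) =
            (if b = a then t else if k b = k a then 1 else 0) * (if \<forall>i\<in>A. k (q i) = k i then F A q else 0)"
        unfolding preserve[OF q b]
        using F_fixed[OF insert.hyps q] F_join[OF insert.hyps q, of b] b by auto
    qed
    also have "\<dots> = (if b = a then t else if k b = k a then 1 else 0) *
        (\<Sum>q\<in>{p. p permutes A}. if \<forall>i\<in>A. k (q i) = k i then F A q else 0)"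
      by (simp only: sum_distrib_left)
    also have "(\<Sum>q\<in>{p. p permutes A}. if \<forall>i\<in>A. k (q i) = k i then F A q else 0) = S"
      unfolding S_def label_perms_def
      by (rule sum.mono_neutral_cong_right) (use insert.hyps in \<open>auto intro: finite_permutations\<close>)
    finally show "(\<Sum>q\<in>{p. p permutes A}.
             if \<forall>i\<in>insert a A. k ((transpose a b \<circ> q) i) = k i then F (insert a A) (transpose a b \<circ> q) else 0) =
             (if b = a then t else if k b = k a then 1 else 0) * S" .
  qed
  also have "\<dots> = (t + real (card {i \<in> A. k i = k a})) * S"
  proof -
    have "(\<Sum>b\<in>A. if b = a then t else if k b = k a then 1 else 0) = real (card {i \<in> A. k i = k a})"
    proof -
      have "(\<Sum>b\<in>A. if b = a then t else if k b = k a then 1 else 0) = (\<Sum>b\<in>A. if k b = k a then 1 else 0)"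
        using insert.hyps by (intro sum.cong) auto
      then show ?thesis
        using insert.hyps by (simp add: sum.If_cases Int_def)
    qed
    then show ?thesis
      using insert.hyps by (simp add: sum_distrib_right[symmetric])
  qed
  also have "S = (\<Prod>v\<in>V. pochhammer t (card {i \<in> A. k i = v}))"
    unfolding S_def using insert by simp
  also have "(t + real (card {i \<in> A. k i = k a})) * (\<Prod>v\<in>V. pochhammer t (card {i \<in> A. k i = v})) =
             (\<Prod>v\<in>V. (if v = k a then t + real (card {i \<in> A. k i = k a}) else 1) * pochhammer t (card {i \<in> A. k i = v}))"
    unfolding prod.distrib using insert.prems \<open>finite V\<close> by simp
  also have "\<dots> = (\<Prod>v\<in>V. pochhammer t (card {i \<in> insert a A. k i = v}))"
  proof (intro prod.cong refl)
    fix v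
    have "{i \<in> insert a A. k i = v} = (if v = k a then insert a {i \<in> A. k i = v} else {i \<in> A. k i = v})"
      by auto
    then show "(if v = k a then t + real (card {i \<in> A. k i = k a}) else 1) * pochhammer t (card {i \<in> A. k i = v}) =
               pochhammer t (card {i \<in> insert a A. k i = v})"
      using insert.hyps by (simp add: pochhammer_Suc)
  qed
  finally show ?case .
qed

lemma card_label_perms:
  assumes "finite A" "finite V" "k ` A \<subseteq> V"
  shows "real (card (label_perms A k)) = (\<Prod>v\<in>V. fact (card {i \<in> A. k i = v}))"
  using sum_label_perms[of "\<lambda>_ _. 1" 1 A V k] assms by (simp add: pochhammer_fact)

text \<open>
  The subsets of \<open>A\<close> invariant under \<open>p\<close> are the unions of cycles, so there are two to the number of cycles
  of them.
\<close>
definition fixed_subsets :: "'a set \<Rightarrow> ('a \<Rightarrow> 'a) \<Rightarrow> 'a set set" where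
  "fixed_subsets A p = {S. S \<subseteq> A \<and> (\<forall>i\<in>A. p i \<in> S \<longleftrightarrow> i \<in> S)}"

lemma finite_fixed_subsets: "finite A \<Longrightarrow> finite (fixed_subsets A p)"
  by (rule finite_subset[of _ "Pow A"]) (auto simp: fixed_subsets_def)

lemma card_fixed_subsets_fixed_point:
  assumes "finite A" "a \<notin> A" "p permutes A"
  shows "card (fixed_subsets (insert a A) p) = 2 * card (fixed_subsets A p)"
proof -
  have pa: "p a = a" and pA: "p i \<in> A \<longleftrightarrow> i \<in> A" for i
    using assms by (auto simp: permutes_def permutes_in_image[OF assms(3)])
  have "fixed_subsets (insert a A) p = fixed_subsets A p \<union> insert a ` fixed_subsets A p"
  proof (intro equalityI subsetI)
    fix S assume S: "S \<in> fixed_subsets (insert a A) p"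
    then have "S - {a} \<in> fixed_subsets A p"
      using assms(2) pA unfolding fixed_subsets_def by auto
    then show "S \<in> fixed_subsets A p \<union> insert a ` fixed_subsets A p"
      by (cases "a \<in> S") (auto simp: image_iff insert_absorb intro!: bexI[of _ "S - {a}"])
  next
    fix S assume "S \<in> fixed_subsets A p \<union> insert a ` fixed_subsets A p"
    then show "S \<in> fixed_subsets (insert a A) p"
      using assms(2) pa pA unfolding fixed_subsets_def by (auto; metis)
  qed
  moreover have "fixed_subsets A p \<inter> insert a ` fixed_subsets A p = {}"
    using assms(2) by (auto simp: fixed_subsets_def)
  moreover have "inj_on (insert a) (fixed_subsets A p)"
    using assms(2) by (intro inj_onI) (metis (mono_tags, lifting) fixed_subsets_def insert_ident mem_Collect_eq subsetD)
  ultimately show ?thesis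
    using assms(1) by (simp add: card_Un_disjoint card_image finite_fixed_subsets)
qed

text \<open>
  The point \<open>a\<close> lies in the cycle of \<open>b\<close>, so an invariant set contains both or neither and is determined by
  its trace on \<open>A\<close>.
\<close>
lemma card_fixed_subsets_join:
  assumes "finite A" "a \<notin> A" "p permutes A" "b \<in> A"
  shows "card (fixed_subsets (insert a A) (transpose a b \<circ> p)) = card (fixed_subsets A p)"
proof (rule bij_betw_same_card[OF bij_betw_byWitness[where f = "\<lambda>S. S - {a}" and f' = "\<lambda>S. if b \<in> S then insert a S else S"]])
  let ?q = "transpose a b \<circ> p"
  have pa: "p a = a" and pA: "p i \<in> A \<longleftrightarrow> i \<in> A" for i
    using assms by (auto simp: permutes_def permutes_in_image[OF assms(3)])
  have ab: "a \<in> S \<longleftrightarrow> b \<in> S" if "S \<in> fixed_subsets (insert a A) ?q" for S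
    using that pa by (auto simp: fixed_subsets_def)
  show "\<forall>S\<in>fixed_subsets (insert a A) ?q. (if b \<in> S - {a} then insert a (S - {a}) else S - {a}) = S"
    using ab assms(2,4) by auto
  show "\<forall>S\<in>fixed_subsets A p. (if b \<in> S then insert a S else S) - {a} = S"
    using assms(2) by (auto simp: fixed_subsets_def)
  show "(\<lambda>S. S - {a}) ` fixed_subsets (insert a A) ?q \<subseteq> fixed_subsets A p"
  proof safe
    fix S assume S: "S \<in> fixed_subsets (insert a A) ?q"
    have "p i \<in> S - {a} \<longleftrightarrow> i \<in> S - {a}" if "i \<in> A" for i
    proof -
      have "?q i \<in> S \<longleftrightarrow> i \<in> S"
        using S that by (auto simp: fixed_subsets_def)
      moreover have "?q i \<in> S \<longleftrightarrow> p i \<in> S"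
        using ab[OF S] by (auto simp: transpose_def)
      moreover have "i \<noteq> a" "p i \<noteq> a"
        using that assms(2) pA by metis+
      ultimately show ?thesis by simp
    qed
    then show "S - {a} \<in> fixed_subsets A p"
      using S by (auto simp: fixed_subsets_def)
  qed
  show "(\<lambda>S. if b \<in> S then insert a S else S) ` fixed_subsets A p \<subseteq> fixed_subsets (insert a A) ?q"
  proof (rule image_subsetI)
    fix S assume S: "S \<in> fixed_subsets A p"
    define T where "T = (if b \<in> S then insert a S else S)"
    have T: "a \<in> T \<longleftrightarrow> b \<in> T" "\<And>i. i \<in> A \<Longrightarrow> i \<in> T \<longleftrightarrow> i \<in> S"
      using S assms(2) by (auto simp: T_def fixed_subsets_def)
    have "?q i \<in> T \<longleftrightarrow> i \<in> T" if "i \<in> insert a A" for i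
    proof -
      have "?q i \<in> T \<longleftrightarrow> p i \<in> T"
        using T(1) by (auto simp: transpose_def)
      also have "\<dots> \<longleftrightarrow> i \<in> T"
        using that pa pA[of i] S T(2) by (auto simp: fixed_subsets_def)
      finally show ?thesis .
    qed
    moreover have "T \<subseteq> insert a A"
      using S by (auto simp: T_def fixed_subsets_def)
    ultimately show "(if b \<in> S then insert a S else S) \<in> fixed_subsets (insert a A) ?q"
      by (auto simp: fixed_subsets_def T_def[symmetric])
  qed
qed

lemma sum_inverse_card_fixed_subsets:
  fixes A :: "'a set"
  assumes "finite A" "finite V" "k ` A \<subseteq> V"
  shows "(\<Sum>p\<in>label_perms A k. 1 / real (card (fixed_subsets A p))) =
         (\<Prod>v\<in>V. pochhammer (1 / 2) (card {i \<in> A. k i = v}))"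
proof (rule sum_label_perms[OF _ _ _ assms])
  have "fixed_subsets {} (id :: 'a \<Rightarrow> 'a) = {{}}"
    by (auto simp: fixed_subsets_def)
  then show "1 / real (card (fixed_subsets {} (id :: 'a \<Rightarrow> 'a))) = 1"
    by simp
next
  fix A :: "'a set" and a b p
  assume "finite A" "a \<notin> A" "p permutes A" "b \<in> A"
  from card_fixed_subsets_join[OF this]
  show "1 / real (card (fixed_subsets (insert a A) (transpose a b \<circ> p))) =
             1 / real (card (fixed_subsets A p))"
    by (simp only:)
qed (simp add: card_fixed_subsets_fixed_point)

section \<open>The Burnside process on the binary cube\<close>

definition ones :: "nat \<Rightarrow> (nat \<Rightarrow> nat) \<Rightarrow> nat set" where
  "ones n x = {i \<in> {1..n}. x i = 1}"

lemma ones_subset: "ones n x \<subseteq> {1..n}"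
  by (auto simp: ones_def)

lemma finite_ones [simp]: "finite (ones n x)"
  by (simp add: ones_def)

lemma card_ones_le: "card (ones n x) \<le> n"
  using card_mono[OF _ ones_subset[of n x]] by simp

lemma binary_cube_values:
  assumes "x \<in> binary_cube n"
  shows "x ` {1..n} \<subseteq> {0, 1}"
  by (rule image_subsetI) (rule PiE_mem[OF assms[unfolded binary_cube_def]])

lemma bij_betw_ones: "bij_betw (ones n) (binary_cube n) (Pow {1..n})"
proof (rule bij_betw_byWitness[where f' = "\<lambda>S. \<lambda>i\<in>{1..n}. if i \<in> S then 1 else 0"])
  show "\<forall>x\<in>binary_cube n. (\<lambda>i\<in>{1..n}. if i \<in> ones n x then 1 else 0) = x"
    by (fastforce simp: binary_cube_def ones_def PiE_def extensional_def fun_eq_iff Pi_def)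
qed (auto simp: binary_cube_def ones_def split: if_splits)

lemma perm_action_eq_iff:
  assumes g: "g permutes {1..n}" and x: "x \<in> binary_cube n"
  shows "perm_action n g x = x \<longleftrightarrow> (\<forall>i\<in>{1..n}. x (g i) = x i)"
proof -
  have "perm_action n g x = x \<longleftrightarrow> (\<forall>i\<in>{1..n}. x (inv' g i) = x i)"
    using x by (auto simp: perm_action_def binary_cube_def PiE_def extensional_def fun_eq_iff)
  also have "\<dots> \<longleftrightarrow> (\<forall>i\<in>{1..n}. x (g i) = x i)"
    using permutes_inverses[OF g] permutes_in_image[OF g] permutes_in_image[OF permutes_inv[OF g]]
    by metis
  finally show ?thesis .
qed

lemma stabilizer_perm_action:
  "x \<in> binary_cube n \<Longrightarrow> stabilizer (sym_group n) (perm_action n) x = label_perms {1..n} x"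
  by (auto simp: stabilizer_def label_perms_def sym_group_def perm_action_eq_iff)

lemma card_invariants_perm_action:
  assumes g: "g permutes {1..n}"
  shows "card (invariants (binary_cube n) (perm_action n) g) = card (fixed_subsets {1..n} g)"
proof (rule bij_betw_same_card)
  have iff: "perm_action n g x = x \<longleftrightarrow> ones n x \<in> fixed_subsets {1..n} g" if x: "x \<in> binary_cube n" for x
  proof -
    have "x i = 0 \<or> x i = 1" if "i \<in> {1..n}" for i
      using x that by (auto simp: binary_cube_def)
    then have "x (g i) = x i \<longleftrightarrow> (g i \<in> ones n x \<longleftrightarrow> i \<in> ones n x)" if "i \<in> {1..n}" for i
      using that permutes_in_image[OF g, of i] unfolding ones_def mem_Collect_eq by (metis zero_neq_one)
    then show ?thesis
      using perm_action_eq_iff[OF g x] ones_subset by (auto simp: fixed_subsets_def)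
  qed
  have "inj_on (ones n) (invariants (binary_cube n) (perm_action n) g)"
    using bij_betw_imp_inj_on[OF bij_betw_ones] by (rule inj_on_subset) (auto simp: invariants_def)
  moreover have "ones n ` invariants (binary_cube n) (perm_action n) g = fixed_subsets {1..n} g"
  proof -
    have "fixed_subsets {1..n} g \<subseteq> ones n ` binary_cube n"
      using bij_betw_imp_surj_on[OF bij_betw_ones[of n]] by (auto simp: fixed_subsets_def)
    then show ?thesis
      using iff by (auto simp: invariants_def)
  qed
  ultimately show "bij_betw (ones n) (invariants (binary_cube n) (perm_action n) g) (fixed_subsets {1..n} g)"
    by (simp add: bij_betw_def)
qed

lemma sum_Pow_card:
  fixes h :: "nat \<Rightarrow> real"
  assumes "finite X" and "card X = m"
  shows "(\<Sum>S\<in>Pow X. h (card S)) = (\<Sum>a\<le>m. real (m choose a) * h a)"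
proof -
  have "(\<Sum>S\<in>Pow X. h (card S)) = (\<Sum>a\<le>m. \<Sum>S\<in>{S \<in> Pow X. card S = a}. h (card S))"
    by (rule sum.group[symmetric]) (use assms in \<open>auto intro: card_mono\<close>)
  also have "\<dots> = (\<Sum>a\<le>m. real (m choose a) * h a)"
    using n_subsets[OF assms(1)] assms(2) by (intro sum.cong) simp_all
  finally show ?thesis .
qed

text \<open>
  A state is a pair of subsets, one of \<open>B\<close> and one of its complement, chosen independently.
\<close>
lemma sum_binary_cube_split:
  fixes h :: "nat \<Rightarrow> nat \<Rightarrow> real"
  assumes "B \<subseteq> {1..n}"
  shows "(\<Sum>y\<in>binary_cube n. h (card (ones n y \<inter> B)) (card (ones n y - B))) =
         (\<Sum>a\<le>card B. \<Sum>b\<le>n - card B. real (card B choose a) * real ((n - card B) choose b) * h a b)"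
proof -
  let ?C = "{1..n} - B"
  have fin: "finite B" "finite ?C" and cC: "card ?C = n - card B"
    using assms finite_subset[OF assms] by (auto simp: card_Diff_subset)
  have "(\<Sum>y\<in>binary_cube n. h (card (ones n y \<inter> B)) (card (ones n y - B))) =
        (\<Sum>S\<in>Pow {1..n}. h (card (S \<inter> B)) (card (S - B)))"
    by (rule sum.reindex_bij_betw[OF bij_betw_ones])
  also have "\<dots> = (\<Sum>(S, T)\<in>Pow B \<times> Pow ?C. h (card S) (card T))"
    by (rule sum.reindex_bij_witness[of _ "\<lambda>(S, T). S \<union> T" "\<lambda>S. (S \<inter> B, S - B)"])
       (use assms in \<open>auto intro!: arg_cong2[where f = h] arg_cong[where f = card]\<close>)
  also have "\<dots> = (\<Sum>S\<in>Pow B. \<Sum>T\<in>Pow ?C. h (card S) (card T))"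
    by (simp add: sum.cartesian_product)
  also have "\<dots> = (\<Sum>a\<le>card B. real (card B choose a) * (\<Sum>b\<le>n - card B. real ((n - card B) choose b) * h a b))"
    unfolding sum_Pow_card[OF fin(2) cC]
    by (rule sum_Pow_card[OF fin(1) refl, where h = "\<lambda>a. \<Sum>b\<le>n - card B. real ((n - card B) choose b) * h a b"])
  finally show ?thesis
    by (simp add: sum_distrib_left mult.assoc)
qed

lemma card_stabilizer_perm_action:
  assumes "x \<in> binary_cube n"
  shows "real (card (stabilizer (sym_group n) (perm_action n) x)) =
         fact (card (ones n x)) * fact (n - card (ones n x))"
proof -
  have x01: "x ` {1..n} \<subseteq> {0, 1}"
    by (rule binary_cube_values[OF assms])
  have "{i \<in> {1..n}. x i = 0} = {1..n} - ones n x"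
    using x01 by (auto simp: ones_def)
  then have "card {i \<in> {1..n}. x i = 0} = n - card (ones n x)"
    using card_Diff_subset[OF finite_ones ones_subset, of n x] by simp
  moreover have "{i \<in> {1..n}. x i = 1} = ones n x"
    by (auto simp: ones_def)
  ultimately show ?thesis
    using card_label_perms[OF _ _ x01] by (simp add: stabilizer_perm_action[OF assms] mult.commute)
qed

text \<open>
  A permutation fixes both \<open>x\<close> and \<open>y\<close> iff it preserves the labelling by the pairs \<open>(x\<^sub>i, y\<^sub>i)\<close>, which
  has four blocks.
\<close>
lemma burnside_kernel_perm_action:
  assumes x: "x \<in> binary_cube n" and y: "y \<in> binary_cube n"
  defines "i \<equiv> card (ones n x)"
  defines "a \<equiv> card (ones n y \<inter> ones n x)" and "b \<equiv> card (ones n y - ones n x)"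
  shows "burnside_kernel (sym_group n) (binary_cube n) (perm_action n) x y =
         pochhammer (1 / 2) a * pochhammer (1 / 2) (i - a) *
         (pochhammer (1 / 2) b * pochhammer (1 / 2) (n - i - b)) / (fact i * fact (n - i))"
proof -
  let ?k = "\<lambda>i. (x i, y i)"
  have x01: "x ` {1..n} \<subseteq> {0, 1}" and y01: "y ` {1..n} \<subseteq> {0, 1}"
    by (rule binary_cube_values[OF x], rule binary_cube_values[OF y])
  have x01': "\<forall>i\<in>{1..n}. x i = 0 \<or> x i = Suc 0" and y01': "\<forall>i\<in>{1..n}. y i = 0 \<or> y i = Suc 0"
    using x01 y01 by force+
  have stab: "stabilizer (sym_group n) (perm_action n) x \<inter> stabilizer (sym_group n) (perm_action n) y =
              label_perms {1..n} ?k"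
    by (auto simp: stabilizer_perm_action x y label_perms_def)
  have "burnside_kernel (sym_group n) (binary_cube n) (perm_action n) x y =
        (\<Sum>g\<in>label_perms {1..n} ?k. 1 / real (card (fixed_subsets {1..n} g))) / (fact i * fact (n - i))"
    unfolding burnside_kernel_def stab card_stabilizer_perm_action[OF x] i_def[symmetric] sum_divide_distrib
    by (intro sum.cong refl) (simp add: card_invariants_perm_action label_perms_def)
  also have "(\<Sum>g\<in>label_perms {1..n} ?k. 1 / real (card (fixed_subsets {1..n} g))) =
      (\<Prod>v\<in>{(1, 1), (1, 0), (0, 1), (0, 0)}. pochhammer (1 / 2) (card {i \<in> {1..n}. ?k i = v}))"
    by (rule sum_inverse_card_fixed_subsets) (use x01 y01 in auto)
  also have "\<dots> = pochhammer (1 / 2) a * pochhammer (1 / 2) (i - a) *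
         (pochhammer (1 / 2) b * pochhammer (1 / 2) (n - i - b))"
  proof -
    have "{i \<in> {1..n}. ?k i = (1, 1)} = ones n y \<inter> ones n x"
      by (auto simp: ones_def)
    moreover have "{i \<in> {1..n}. ?k i = (1, 0)} = ones n x - ones n y \<inter> ones n x"
      using y01' by (fastforce simp: ones_def)
    then have "card {i \<in> {1..n}. ?k i = (1, 0)} = i - a"
      by (simp add: card_Diff_subset i_def a_def)
    moreover have "{i \<in> {1..n}. ?k i = (0, 1)} = ones n y - ones n x"
      using x01' by (fastforce simp: ones_def)
    moreover have "{i \<in> {1..n}. ?k i = (0, 0)} = {1..n} - ones n x - (ones n y - ones n x)"
      using x01' y01' by (fastforce simp: ones_def)
    then have "card {i \<in> {1..n}. ?k i = (0, 0)} = n - i - b"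
      using card_Diff_subset[OF _ ones_subset[of n x]]
        card_Diff_subset[OF _ Diff_mono[OF ones_subset[of n y] order_refl[of "ones n x"]]]
      by (simp add: i_def b_def)
    ultimately show ?thesis by (simp add: a_def b_def mult_ac)
  qed
  finally show ?thesis .
qed

lemma burnside_kernel_lumped:
  assumes x: "x \<in> binary_cube n"
  shows "(\<Sum>y\<in>binary_cube n. burnside_kernel (sym_group n) (binary_cube n) (perm_action n) x y * f (card (ones n y))) =
         lumped_op n f (card (ones n x))"
proof -
  define i where "i = card (ones n x)"
  define h where "h = (\<lambda>a b. pochhammer (1 / 2) a * pochhammer (1 / 2) (i - a) *
         (pochhammer (1 / 2) b * pochhammer (1 / 2) (n - i - b)) / (fact i * fact (n - i)) * f (a + b))"
  have "(\<Sum>y\<in>binary_cube n. burnside_kernel (sym_group n) (binary_cube n) (perm_action n) x y * f (card (ones n y))) =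
        (\<Sum>y\<in>binary_cube n. h (card (ones n y \<inter> ones n x)) (card (ones n y - ones n x)))"
  proof (intro sum.cong refl)
    fix y assume y: "y \<in> binary_cube n"
    have "card (ones n y) = card (ones n y \<inter> ones n x) + card (ones n y - ones n x)"
      by (subst card_Un_disjoint[symmetric]) (auto intro: arg_cong[where f = card])
    then show "burnside_kernel (sym_group n) (binary_cube n) (perm_action n) x y * f (card (ones n y)) =
               h (card (ones n y \<inter> ones n x)) (card (ones n y - ones n x))"
      by (simp add: burnside_kernel_perm_action[OF x y] h_def i_def)
  qed
  also have "\<dots> = (\<Sum>a\<le>i. \<Sum>b\<le>n - i. real (i choose a) * real ((n - i) choose b) * h a b)"
    unfolding i_def by (rule sum_binary_cube_split[OF ones_subset])
  also have "\<dots> = lumped_op n f i"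
    unfolding lumped_op_def
  proof (intro sum.cong refl)
    fix a b assume "a \<in> {..i}" "b \<in> {..n - i}"
    then show "real (i choose a) * real ((n - i) choose b) * h a b =
               central a * central (i - a) * (central b * central (n - i - b)) * f (a + b)"
      by (simp add: h_def central_def binomial_fact field_simps)
  qed
  finally show ?thesis by (simp add: i_def)
qed

text \<open>
  Orbit sizes come from the stabilisers, and the number of orbits from the fact that the stationary
  probabilities add up to \<open>1\<close>.
\<close>
lemma burnside_stationary_perm_action:
  assumes x: "x \<in> binary_cube n"
  shows "burnside_stationary (sym_group n) (binary_cube n) (perm_action n) x =
         1 / (real (n + 1) * real (n choose card (ones n x)))"
proof -
  interpret group_action "sym_group n" "binary_cube n" "perm_action n"
    by (rule group_action_perm_action)
  let ?\<pi> = "burnside_stationary (sym_group n) (binary_cube n) (perm_action n)"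
  define z where "z = real (card (orbits (sym_group n) (binary_cube n) (perm_action n)))"
  have fin: "finite (carrier (sym_group n))" and order: "Coset.order (sym_group n) = fact n"
    by (auto simp: sym_group_def Coset.order_def finite_permutations card_permutations)
  have \<pi>: "?\<pi> x = 1 / (z * real (n choose card (ones n x)))" if x: "x \<in> binary_cube n" for x
  proof -
    have "real (card (orbit (sym_group n) (perm_action n) x)) * real (card (stabilizer (sym_group n) (perm_action n) x)) = fact n"
      using orbit_stabilizer_theorem[OF x] order by (metis of_nat_fact of_nat_mult)
    then have "real (card (orbit (sym_group n) (perm_action n) x)) = real (n choose card (ones n x))"
      by (simp add: card_stabilizer_perm_action[OF x] binomial_fact card_ones_le field_simps)
    then show ?thesis
      by (simp add: burnside_stationary_def z_def)
  qed
  have "1 = (\<Sum>x\<in>binary_cube n. ?\<pi> x)"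
    using burnside_stationary_sum[OF fin finite_binary_cube] all_ones_in_binary_cube by (metis empty_iff)
  also have "\<dots> = (\<Sum>x\<in>binary_cube n. 1 / (z * real (n choose card (ones n x))))"
    by (intro sum.cong refl \<pi>)
  also have "\<dots> = (\<Sum>S\<in>Pow {1..n}. 1 / (z * real (n choose card S)))"
    by (rule sum.reindex_bij_betw[OF bij_betw_ones])
  also have "\<dots> = (\<Sum>a\<le>n. real (n choose a) * (1 / (z * real (n choose a))))"
    by (rule sum_Pow_card[where h = "\<lambda>a. 1 / (z * real (n choose a))"]) simp_all
  also have "\<dots> = (\<Sum>a\<le>n. 1 / z)"
    by (intro sum.cong refl) simp
  finally have "z = real (n + 1)"
    by (cases "z = 0") (simp_all add: field_simps)
  with \<pi>[OF x] show ?thesis by simp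
qed

text \<open>
  By detailed balance the density of the \<open>l\<close>-step distribution with respect to the stationary one evolves by the
  kernel acting on functions.  The initial density is a function of the level, and the kernel preserves such
  functions.
\<close>
lemma matrix_power_burnside_kernel:
  assumes "y \<in> binary_cube n"
  shows "matrix_power (binary_cube n) (burnside_kernel (sym_group n) (binary_cube n) (perm_action n)) l (all_ones n) y =
         burnside_stationary (sym_group n) (binary_cube n) (perm_action n) y *
         (real (n + 1) * (lumped_op n ^^ l) (point_mass n) (card (ones n y)))"
  using assms
proof (induction l arbitrary: y)
  case 0
  have "ones n (all_ones n) = {1..n}"
    by (auto simp: ones_def all_ones_def)
  moreover have "all_ones n = y" if "card (ones n y) = n"
  proof -
    have "ones n y = {1..n}"
      using card_subset_eq[OF _ ones_subset, of n y] that by simp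
    then show ?thesis
      using bij_betw_imp_inj_on[OF bij_betw_ones[of n]] 0 all_ones_in_binary_cube \<open>ones n (all_ones n) = {1..n}\<close>
      by (metis inj_onD)
  qed
  ultimately have iff: "all_ones n = y \<longleftrightarrow> card (ones n y) = n"
    by auto
  show ?case
    using 0 by (simp add: iff point_mass_eq card_ones_le burnside_stationary_perm_action)
next
  case (Suc l)
  let ?X = "binary_cube n"
  let ?K = "burnside_kernel (sym_group n) ?X (perm_action n)"
  let ?\<pi> = "burnside_stationary (sym_group n) ?X (perm_action n)"
  let ?h = "(lumped_op n ^^ l) (point_mass n)"
  have "matrix_power ?X ?K (Suc l) (all_ones n) y =
        (\<Sum>z\<in>?X. ?\<pi> y * (real (n + 1) * (?K y z * ?h (card (ones n z)))))"
    unfolding matrix_power.simps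
  proof (intro sum.cong refl)
    fix z assume z: "z \<in> ?X"
    let ?N = "real (n + 1)" and ?hz = "?h (card (ones n z))"
    have balance: "?\<pi> z * ?K z y = ?\<pi> y * ?K y z"
      by (rule group_action.burnside_detailed_balance[OF group_action_perm_action z Suc.prems])
    have "matrix_power ?X ?K l (all_ones n) z * ?K z y = (?\<pi> z * ?K z y) * (?N * ?hz)"
      unfolding Suc.IH[OF z] by (simp only: mult_ac)
    also have "\<dots> = ?\<pi> y * (?N * (?K y z * ?hz))"
      unfolding balance by (simp only: mult_ac)
    finally show "matrix_power ?X ?K l (all_ones n) z * ?K z y = ?\<pi> y * (?N * (?K y z * ?hz))" .
  qed
  also have "\<dots> = ?\<pi> y * (real (n + 1) * lumped_op n ?h (card (ones n y)))"
    unfolding sum_distrib_left[symmetric] burnside_kernel_lumped[OF Suc.prems] ..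
  finally show ?case by simp
qed

lemma total_variation_burnside:
  "total_variation (binary_cube n)
     (matrix_power (binary_cube n) (burnside_kernel (sym_group n) (binary_cube n) (perm_action n)) l (all_ones n))
     (burnside_stationary (sym_group n) (binary_cube n) (perm_action n)) = lumped_distance n l"
proof -
  let ?X = "binary_cube n"
  let ?h = "(lumped_op n ^^ l) (point_mass n)"
  define H where "H = (\<lambda>a. 1 / real (n choose a) * \<bar>?h a - 1 / real (n + 1)\<bar>)"
  have "(\<Sum>y\<in>?X. \<bar>matrix_power ?X (burnside_kernel (sym_group n) ?X (perm_action n)) l (all_ones n) y -
            burnside_stationary (sym_group n) ?X (perm_action n) y\<bar>) = (\<Sum>y\<in>?X. H (card (ones n y)))"
  proof (intro sum.cong refl)
    fix y assume y: "y \<in> ?X"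
    define c where "c = real (n choose card (ones n y))"
    have "c > 0" by (simp add: c_def card_ones_le)
    have "1 / (real (n + 1) * c) * (real (n + 1) * ?h (card (ones n y))) - 1 / (real (n + 1) * c) =
          1 / c * (?h (card (ones n y)) - 1 / real (n + 1))"
    proof -
      define N where "N = real (n + 1)"
      have "N > 0" by (simp add: N_def)
      with \<open>c > 0\<close> show ?thesis
        unfolding N_def[symmetric] by (simp add: field_simps)
    qed
    then show "\<bar>matrix_power ?X (burnside_kernel (sym_group n) ?X (perm_action n)) l (all_ones n) y -
            burnside_stationary (sym_group n) ?X (perm_action n) y\<bar> = H (card (ones n y))"
      using \<open>c > 0\<close>
      by (simp only: matrix_power_burnside_kernel[OF y] burnside_stationary_perm_action[OF y] H_def c_def[symmetric] abs_mult)
         simp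
  qed
  also have "\<dots> = (\<Sum>S\<in>Pow {1..n}. H (card S))"
    by (rule sum.reindex_bij_betw[OF bij_betw_ones])
  also have "\<dots> = (\<Sum>a\<le>n. real (n choose a) * H a)"
    by (rule sum_Pow_card) simp_all
  also have "\<dots> = (\<Sum>a\<le>n. \<bar>?h a - 1 / real (n + 1)\<bar>)"
    by (intro sum.cong refl) (simp add: H_def)
  finally show ?thesis
    by (simp add: total_variation_def lumped_distance_def)
qed

theorem theorem1p1:
  fixes n l :: nat
  defines "X \<equiv> binary_cube n"
  defines "K \<equiv> burnside_kernel (sym_group n) X (perm_action n)"
  defines "\<pi> \<equiv> burnside_stationary (sym_group n) X (perm_action n)"
  defines "x\<^sub>0 \<equiv> all_ones n"
  assumes "n \<ge> 2" and "l \<ge> 1"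
  shows "1 / 4 * (1 / 4) ^ l \<le> total_variation X (matrix_power X K l x\<^sub>0) \<pi>
       \<and> total_variation X (matrix_power X K l x\<^sub>0) \<pi> \<le> 4 * (1 / 4) ^ l"
  unfolding assms(1-4) total_variation_burnside
  using lumped_distance_ge[OF assms(5)] lumped_distance_le[OF assms(6)] by blast

end
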